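(* Let $K$ be a field, $\lambda\in K$. Let $(M,\triangleright,\triangleleft,\rho,\varphi)$ be a $\lambda$-inf-Hopf bimodule over a $\lambda$-inf-bialgebra $(A,\mu,\Delta)$. Let $\alpha_A,\beta_A,\psi_A,\omega_A:A\to A$ be morphisms of algebras and coalgebras such that any two of them commute, and let $\alpha_M,\beta_M,\psi_M,\omega_M:M\to M$ be linear maps such that any two of them commute and, for each $f\in\{\alpha,\beta,\psi,\omega\}$, $a\in A$, $m\in M$, $$f_M(a\triangleright m)=f_A(a)\triangleright f_M(m),\quad f_M(m\triangleleft a)=f_M(m)\triangleleft f_A(a),\quad \rho f_M=(f_A\otimes f_M)\rho,\quad \varphi f_M=(f_M\otimes f_A)\varphi.$$ Then $$\big(M,\ \triangleright\circ(\alpha_A\otimes\beta_M),\ \triangleleft\circ(\alpha_M\otimes\beta_A),\ (\omega_A\otimes\psi_M)\circ\rho,\ (\omega_M\otimes\psi_A)\circ\varphi,\ \alpha_M,\beta_M,\psi_M,\omega_M\big)$$ is a $\lambda$-infBH-Hopf bimodule over the $\lambda$-infBH-bialgebra $(A,\ \mu\circ(\alpha_A\otimes\beta_A),\ (\omega_A\otimes\psi_A)\circ\Delta,\ \alpha_A,\beta_A,\psi_A,\omega_A)$.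
   Context: Everything is over the field $K$; (co)units are not assumed. BiHom-associative algebra $(A,\mu,\alpha,\beta)$: $\mu$ (written $ab$) and $\alpha,\beta$ linear, $\alpha\beta=\beta\alpha$, $\alpha,\beta$ multiplicative, $\alpha(a)(bc)=(ab)\beta(c)$. BiHom-coassociative coalgebra $(C,\Delta,\psi,\omega)$: $\psi\omega=\omega\psi$, $(\psi\otimes\psi)\Delta=\Delta\psi$, $(\omega\otimes\omega)\Delta=\Delta\omega$, $(\Delta\otimes\psi)\Delta=(\omega\otimes\Delta)\Delta$. $\lambda$-infBH-bialgebra $(A,\mu,\Delta,\alpha,\beta,\psi,\omega)$: $(A,\mu,\alpha,\beta)$ BiHom-associative, $(A,\Delta,\psi,\omega)$ BiHom-coassociative, each of $\alpha,\beta$ commutes with each of $\psi,\omega$, $(\alpha\otimes\alpha)\Delta=\Delta\alpha$, $(\beta\otimes\beta)\Delta=\Delta\beta$, $\psi,\omega$ multiplicative, and (with $\Delta(a)=a_1\otimes a_2$) $\Delta(ab)=\omega(a)b_1\otimes\beta(b_2)+\alpha(a_1)\otimes a_2\psi(b)+\lambda\,\alpha\omega(a)\otimes\beta\psi(b)$. A $\lambda$-inf-bialgebra $(A,\mu,\Delta)$ is the case $\alpha=\beta=\psi=\omega=\mathrm{id}$. Bimodule $(M,\triangleright,\triangleleft,\alpha_M,\beta_M)$: $\alpha_M\beta_M=\beta_M\alpha_M$; $f_M(a\triangleright m)=f_A(a)\triangleright f_M(m)$, $f_M(m\triangleleft a)=f_M(m)\triangleleft f_A(a)$ for $f\in\{\alpha,\beta\}$;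 $\alpha_A(a)\triangleright(a'\triangleright m)=(aa')\triangleright\beta_M(m)$; $\alpha_M(m)\triangleleft(aa')=(m\triangleleft a)\triangleleft\beta_A(a')$; $\alpha_A(a)\triangleright(m\triangleleft a')=(a\triangleright m)\triangleleft\beta_A(a')$. Bicomodule $(M,\rho,\varphi,\psi_M,\omega_M)$, $\rho:M\to A\otimes M$, $\varphi:M\to M\otimes A$: $\psi_M\omega_M=\omega_M\psi_M$; $(g_A\otimes g_M)\rho=\rho g_M$, $(g_M\otimes g_A)\varphi=\varphi g_M$ for $g\in\{\psi,\omega\}$; $(\omega_A\otimes\rho)\rho=(\Delta\otimes\psi_M)\rho$; $(\omega_M\otimes\Delta)\varphi=(\varphi\otimes\psi_A)\varphi$; $(\omega_A\otimes\varphi)\rho=(\rho\otimes\psi_A)\varphi$. $\lambda$-infBH-Hopf bimodule $(M,\triangleright,\triangleleft,\rho,\varphi,\alpha_M,\beta_M,\psi_M,\omega_M)$: any two of $\alpha_M,\beta_M,\psi_M,\omega_M$ commute; it is a bimodule and a bicomodule; and, writing $\rho(m)=m_{(-1)}\otimes m_{(0)}$, $\varphi(m)=m_{(0)}\otimes m_{(1)}$, $\rho(a\triangleright m)=\omega_A(a)m_{(-1)}\otimes\beta_M(m_{(0)})+\alpha_A(a_1)\otimes a_2\triangleright\psi_M(m)+\lambda\,\alpha_A\omega_A(a)\otimes\beta_M\psi_M(m)$, $\varphi(m\triangleleft a)=\omega_M(m)\triangleleft a_1\otimes\beta_A(a_2)+\alpha_M(m_{(0)})\otimes m_{(1)}\psi_A(a)+\lambda\,\alpha_M\omega_M(m)\otimes\beta_A\psi_A(a)$,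 $\varphi(a\triangleright m)=\omega_A(a)\triangleright m_{(0)}\otimes\beta_A(m_{(1)})$, $\rho(m\triangleleft a)=\alpha_A(m_{(-1)})\otimes m_{(0)}\triangleleft\psi_A(a)$. A $\lambda$-inf-Hopf bimodule $(M,\triangleright,\triangleleft,\rho,\varphi)$ is the case where all eight structure maps are identities. *)

theory Defs
  imports "HOL-Algebra.Module" "HOL-Algebra.Generated_Groups" "HOL-Algebra.Free_Abelian_Groups"
begin

section \<open>Linear and bilinear maps\<close>

definition linear_maps ::
  "('k, 'x) ring_scheme \<Rightarrow> ('k, 'v, 'y) module_scheme \<Rightarrow> ('k, 'w, 'z) module_scheme \<Rightarrow> ('v \<Rightarrow> 'w) set"
  where "linear_maps K V W =
    {f \<in> carrier V \<rightarrow> carrier W.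
      (\<forall>x\<in>carrier V. \<forall>y\<in>carrier V. f (x \<oplus>\<^bsub>V\<^esub> y) = f x \<oplus>\<^bsub>W\<^esub> f y) \<and>
      (\<forall>c\<in>carrier K. \<forall>x\<in>carrier V. f (c \<odot>\<^bsub>V\<^esub> x) = c \<odot>\<^bsub>W\<^esub> f x)}"

definition bilinear_maps ::
  "('k, 'x) ring_scheme \<Rightarrow> ('k, 'u, 'y) module_scheme \<Rightarrow> ('k, 'v, 'z) module_scheme \<Rightarrow>
   ('k, 'w, 't) module_scheme \<Rightarrow> ('u \<Rightarrow> 'v \<Rightarrow> 'w) set"
  where "bilinear_maps K U V W =
    {h. (\<forall>u\<in>carrier U. h u \<in> linear_maps K V W) \<and>
        (\<forall>v\<in>carrier V. (\<lambda>u. h u v) \<in> linear_maps K U W)}"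


section \<open>Tensor products\<close>

text \<open>
  The tensor product of V and W is the quotient of the free abelian group on V \<times> W by the
  subgroup generated by the relations of biadditivity and K-balancedness; its elements are cosets.
\<close>

definition tensor_relations ::
  "('k, 'x) ring_scheme \<Rightarrow> ('k, 'v, 'y) module_scheme \<Rightarrow> ('k, 'w, 'z) module_scheme \<Rightarrow>
   ('v \<times> 'w \<Rightarrow>\<^sub>0 int) set"
  where "tensor_relations K V W =
    {frag_of (v \<oplus>\<^bsub>V\<^esub> v', w) - frag_of (v, w) - frag_of (v', w) | v v' w.
       v \<in> carrier V \<and> v' \<in> carrier V \<and> w \<in> carrier W} \<union>
    {frag_of (v, w \<oplus>\<^bsub>W\<^esub> w') - frag_of (v, w) - frag_of (v, w') | v w w'.
       v \<in> carrier V \<and> w \<in> carrier W \<and> w' \<in> carrier W} \<union>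
    {frag_of (c \<odot>\<^bsub>V\<^esub> v, w) - frag_of (v, c \<odot>\<^bsub>W\<^esub> w) | c v w.
       c \<in> carrier K \<and> v \<in> carrier V \<and> w \<in> carrier W}"

definition tensor_free ::
  "('k, 'v, 'y) module_scheme \<Rightarrow> ('k, 'w, 'z) module_scheme \<Rightarrow> ('v \<times> 'w \<Rightarrow>\<^sub>0 int) monoid"
  where "tensor_free V W = free_Abelian_group (carrier V \<times> carrier W)"

definition tensor_kernel ::
  "('k, 'x) ring_scheme \<Rightarrow> ('k, 'v, 'y) module_scheme \<Rightarrow> ('k, 'w, 'z) module_scheme \<Rightarrow>
   ('v \<times> 'w \<Rightarrow>\<^sub>0 int) set"
  where "tensor_kernel K V W = generate (tensor_free V W) (tensor_relations K V W)"

definition tensor_class ::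
  "('k, 'x) ring_scheme \<Rightarrow> ('k, 'v, 'y) module_scheme \<Rightarrow> ('k, 'w, 'z) module_scheme \<Rightarrow>
   ('v \<times> 'w \<Rightarrow>\<^sub>0 int) \<Rightarrow> ('v \<times> 'w \<Rightarrow>\<^sub>0 int) set"
  where "tensor_class K V W x = tensor_kernel K V W #>\<^bsub>tensor_free V W\<^esub> x"

text \<open>
  A scalar c acts by c (v \<otimes> w) = (c v) \<otimes> w.  The ring multiplication and unit
  that every module record carries play no role in the locale \<^locale>\<open>module\<close>.
\<close>

definition tensor ::
  "('k, 'x) ring_scheme \<Rightarrow> ('k, 'v, 'y) module_scheme \<Rightarrow> ('k, 'w, 'z) module_scheme \<Rightarrow>
   ('k, ('v \<times> 'w \<Rightarrow>\<^sub>0 int) set) module"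
  where "tensor K V W =
    (let Q = tensor_free V W Mod tensor_kernel K V W in
     \<lparr>carrier = carrier Q, monoid.mult = undefined, one = undefined,
      ring.zero = \<one>\<^bsub>Q\<^esub>, ring.add = (\<otimes>\<^bsub>Q\<^esub>),
      smult = (\<lambda>c X. \<Union>x\<in>X. tensor_class K V W
        (frag_extend (\<lambda>(v, w). frag_of (c \<odot>\<^bsub>V\<^esub> v, w)) x))\<rparr>)"

definition pure_tensor ::
  "('k, 'x) ring_scheme \<Rightarrow> ('k, 'v, 'y) module_scheme \<Rightarrow> ('k, 'w, 'z) module_scheme \<Rightarrow>
   'v \<Rightarrow> 'w \<Rightarrow> ('v \<times> 'w \<Rightarrow>\<^sub>0 int) set"
  where "pure_tensor K V W v w = tensor_class K V W (frag_of (v, w))"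

text \<open>
  The map \<open>tensor_lift P h\<close> is the linear map into P sending v \<otimes> w to \<open>h v w\<close>, for bilinear h:
  all representatives x of the coset X give the same value, which \<^const>\<open>the_elem\<close> extracts.
\<close>

definition tensor_lift ::
  "('k, 'p, 'z) module_scheme \<Rightarrow> ('v \<Rightarrow> 'w \<Rightarrow> 'p) \<Rightarrow> ('v \<times> 'w \<Rightarrow>\<^sub>0 int) set \<Rightarrow> 'p"
  where "tensor_lift P h X =
    the_elem ((\<lambda>x. \<Oplus>\<^bsub>P\<^esub>p\<in>Poly_Mapping.keys x.
                     [Poly_Mapping.lookup x p] \<cdot>\<^bsub>P\<^esub> h (fst p) (snd p)) ` X)"

text \<open>\<open>tensor_map K V' W' f g\<close> is f \<otimes> g, with values in the tensor product of \<open>V'\<close> and \<open>W'\<close>.\<close>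

definition tensor_map ::
  "('k, 'x) ring_scheme \<Rightarrow> ('k, 'c, 'y) module_scheme \<Rightarrow> ('k, 'd, 'z) module_scheme \<Rightarrow>
   ('v \<Rightarrow> 'c) \<Rightarrow> ('w \<Rightarrow> 'd) \<Rightarrow> ('v \<times> 'w \<Rightarrow>\<^sub>0 int) set \<Rightarrow> ('c \<times> 'd \<Rightarrow>\<^sub>0 int) set"
  where "tensor_map K V' W' f g =
    tensor_lift (tensor K V' W') (\<lambda>v w. pure_tensor K V' W' (f v) (g w))"

text \<open>The canonical isomorphism (u \<otimes> v) \<otimes> w \<mapsto> u \<otimes> (v \<otimes> w).\<close>

definition tensor_assoc ::
  "('k, 'x) ring_scheme \<Rightarrow> ('k, 'u, 'y) module_scheme \<Rightarrow> ('k, 'v, 'z) module_scheme \<Rightarrow>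
   ('k, 'w, 't) module_scheme \<Rightarrow> (('u \<times> 'v \<Rightarrow>\<^sub>0 int) set \<times> 'w \<Rightarrow>\<^sub>0 int) set \<Rightarrow>
   ('u \<times> ('v \<times> 'w \<Rightarrow>\<^sub>0 int) set \<Rightarrow>\<^sub>0 int) set"
  where "tensor_assoc K U V W =
    (let T = tensor K U (tensor K V W) in
     tensor_lift T (\<lambda>X w. tensor_lift T
       (\<lambda>u v. pure_tensor K U (tensor K V W) u (pure_tensor K V W v w)) X))"


section \<open>BiHom-associative algebras and BiHom-coassociative coalgebras\<close>

locale bihom_assoc_algebra = field K + module K A
  for K :: "('k, 'x) ring_scheme" and A :: "('k, 'a, 'y) module_scheme" +
  fixes mult_A :: "'a \<Rightarrow> 'a \<Rightarrow> 'a"  (infixl \<open>\<bullet>\<close> 70)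
    and \<alpha>\<^sub>A \<beta>\<^sub>A :: "'a \<Rightarrow> 'a"
  assumes mult_bilinear: "(\<bullet>) \<in> bilinear_maps K A A A"
    and alpha_linear: "\<alpha>\<^sub>A \<in> linear_maps K A A"
    and beta_linear: "\<beta>\<^sub>A \<in> linear_maps K A A"
    and alpha_beta: "\<forall>a\<in>carrier A. \<alpha>\<^sub>A (\<beta>\<^sub>A a) = \<beta>\<^sub>A (\<alpha>\<^sub>A a)"
    and alpha_mult: "\<forall>a\<in>carrier A. \<forall>b\<in>carrier A. \<alpha>\<^sub>A (a \<bullet> b) = \<alpha>\<^sub>A a \<bullet> \<alpha>\<^sub>A b"
    and beta_mult: "\<forall>a\<in>carrier A. \<forall>b\<in>carrier A. \<beta>\<^sub>A (a \<bullet> b) = \<beta>\<^sub>A a \<bullet> \<beta>\<^sub>A b"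
    and bihom_assoc: "\<forall>a\<in>carrier A. \<forall>b\<in>carrier A. \<forall>c\<in>carrier A.
      \<alpha>\<^sub>A a \<bullet> (b \<bullet> c) = (a \<bullet> b) \<bullet> \<beta>\<^sub>A c"

locale bihom_coassoc_coalgebra = field K + module K A
  for K :: "('k, 'x) ring_scheme" and A :: "('k, 'a, 'y) module_scheme" +
  fixes \<Delta> :: "'a \<Rightarrow> ('a \<times> 'a \<Rightarrow>\<^sub>0 int) set"
    and \<psi>\<^sub>A \<omega>\<^sub>A :: "'a \<Rightarrow> 'a"
  assumes Delta_linear: "\<Delta> \<in> linear_maps K A (tensor K A A)"
    and psi_linear: "\<psi>\<^sub>A \<in> linear_maps K A A"
    and omega_linear: "\<omega>\<^sub>A \<in> linear_maps K A A"
    and psi_omega: "\<forall>a\<in>carrier A. \<psi>\<^sub>A (\<omega>\<^sub>A a) = \<omega>\<^sub>A (\<psi>\<^sub>A a)"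
    and psi_Delta: "\<forall>a\<in>carrier A. tensor_map K A A \<psi>\<^sub>A \<psi>\<^sub>A (\<Delta> a) = \<Delta> (\<psi>\<^sub>A a)"
    and omega_Delta: "\<forall>a\<in>carrier A. tensor_map K A A \<omega>\<^sub>A \<omega>\<^sub>A (\<Delta> a) = \<Delta> (\<omega>\<^sub>A a)"
    and bihom_coassoc: "\<forall>a\<in>carrier A.
      tensor_assoc K A A A (tensor_map K (tensor K A A) A \<Delta> \<psi>\<^sub>A (\<Delta> a)) =
      tensor_map K A (tensor K A A) \<omega>\<^sub>A \<Delta> (\<Delta> a)"


section \<open>Infinitesimal BiHom-bialgebras\<close>

text \<open>
  Sweedler sums are rendered by tensor products of linear maps, for instance
  \<open>\<omega>(a) b\<^sub>1 \<otimes> \<beta>(b\<^sub>2)\<close> by the map \<open>(\<lambda>x. \<omega>(a) x) \<otimes> \<beta>\<close> applied to \<open>\<Delta>(b)\<close>.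
\<close>

locale infBH_bialgebra =
  bihom_assoc_algebra K A mult_A \<alpha>\<^sub>A \<beta>\<^sub>A + bihom_coassoc_coalgebra K A \<Delta> \<psi>\<^sub>A \<omega>\<^sub>A
  for K :: "('k, 'x) ring_scheme" and lam :: 'k and A :: "('k, 'a, 'y) module_scheme"
    and mult_A :: "'a \<Rightarrow> 'a \<Rightarrow> 'a"  (infixl \<open>\<bullet>\<close> 70)
    and \<Delta> :: "'a \<Rightarrow> ('a \<times> 'a \<Rightarrow>\<^sub>0 int) set"
    and \<alpha>\<^sub>A \<beta>\<^sub>A \<psi>\<^sub>A \<omega>\<^sub>A :: "'a \<Rightarrow> 'a" +
  assumes lam_closed: "lam \<in> carrier K"
    and alpha_psi: "\<forall>a\<in>carrier A. \<alpha>\<^sub>A (\<psi>\<^sub>A a) = \<psi>\<^sub>A (\<alpha>\<^sub>A a)"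
    and alpha_omega: "\<forall>a\<in>carrier A. \<alpha>\<^sub>A (\<omega>\<^sub>A a) = \<omega>\<^sub>A (\<alpha>\<^sub>A a)"
    and beta_psi: "\<forall>a\<in>carrier A. \<beta>\<^sub>A (\<psi>\<^sub>A a) = \<psi>\<^sub>A (\<beta>\<^sub>A a)"
    and beta_omega: "\<forall>a\<in>carrier A. \<beta>\<^sub>A (\<omega>\<^sub>A a) = \<omega>\<^sub>A (\<beta>\<^sub>A a)"
    and alpha_Delta: "\<forall>a\<in>carrier A. tensor_map K A A \<alpha>\<^sub>A \<alpha>\<^sub>A (\<Delta> a) = \<Delta> (\<alpha>\<^sub>A a)"
    and beta_Delta: "\<forall>a\<in>carrier A. tensor_map K A A \<beta>\<^sub>A \<beta>\<^sub>A (\<Delta> a) = \<Delta> (\<beta>\<^sub>A a)"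
    and psi_mult: "\<forall>a\<in>carrier A. \<forall>b\<in>carrier A. \<psi>\<^sub>A (a \<bullet> b) = \<psi>\<^sub>A a \<bullet> \<psi>\<^sub>A b"
    and omega_mult: "\<forall>a\<in>carrier A. \<forall>b\<in>carrier A. \<omega>\<^sub>A (a \<bullet> b) = \<omega>\<^sub>A a \<bullet> \<omega>\<^sub>A b"
    and Delta_mult: "\<forall>a\<in>carrier A. \<forall>b\<in>carrier A.
      \<Delta> (a \<bullet> b) =
        tensor_map K A A (\<lambda>x. \<omega>\<^sub>A a \<bullet> x) \<beta>\<^sub>A (\<Delta> b)
        \<oplus>\<^bsub>tensor K A A\<^esub> tensor_map K A A \<alpha>\<^sub>A (\<lambda>x. x \<bullet> \<psi>\<^sub>A b) (\<Delta> a)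
        \<oplus>\<^bsub>tensor K A A\<^esub> lam \<odot>\<^bsub>tensor K A A\<^esub>
             pure_tensor K A A (\<alpha>\<^sub>A (\<omega>\<^sub>A a)) (\<beta>\<^sub>A (\<psi>\<^sub>A b))"

definition inf_bialgebra ::
  "('k, 'x) ring_scheme \<Rightarrow> 'k \<Rightarrow> ('k, 'a, 'y) module_scheme \<Rightarrow> ('a \<Rightarrow> 'a \<Rightarrow> 'a) \<Rightarrow>
   ('a \<Rightarrow> ('a \<times> 'a \<Rightarrow>\<^sub>0 int) set) \<Rightarrow> bool"
  where "inf_bialgebra K lam A mult_A \<Delta> \<longleftrightarrow> infBH_bialgebra K lam A mult_A \<Delta> id id id id"

definition bialgebra_endomorphism ::
  "('k, 'x) ring_scheme \<Rightarrow> ('k, 'a, 'y) module_scheme \<Rightarrow> ('a \<Rightarrow> 'a \<Rightarrow> 'a) \<Rightarrow>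
   ('a \<Rightarrow> ('a \<times> 'a \<Rightarrow>\<^sub>0 int) set) \<Rightarrow> ('a \<Rightarrow> 'a) \<Rightarrow> bool"
  where "bialgebra_endomorphism K A mult_A \<Delta> f \<longleftrightarrow>
    f \<in> linear_maps K A A \<and>
    (\<forall>a\<in>carrier A. \<forall>b\<in>carrier A. f (mult_A a b) = mult_A (f a) (f b)) \<and>
    (\<forall>a\<in>carrier A. tensor_map K A A f f (\<Delta> a) = \<Delta> (f a))"


section \<open>Bimodules, bicomodules and Hopf bimodules\<close>

locale bihom_bimodule =
  bihom_assoc_algebra K A mult_A \<alpha>\<^sub>A \<beta>\<^sub>A + M: module K M
  for K :: "('k, 'x) ring_scheme" and A :: "('k, 'a, 'y) module_scheme"
    and mult_A :: "'a \<Rightarrow> 'a \<Rightarrow> 'a"  (infixl \<open>\<bullet>\<close> 70)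
    and \<alpha>\<^sub>A \<beta>\<^sub>A :: "'a \<Rightarrow> 'a"
    and M :: "('k, 'm, 'z) module_scheme" +
  fixes lact :: "'a \<Rightarrow> 'm \<Rightarrow> 'm"  (infixr \<open>\<triangleright>\<close> 70)
    and ract :: "'m \<Rightarrow> 'a \<Rightarrow> 'm"  (infixl \<open>\<triangleleft>\<close> 70)
    and \<alpha>\<^sub>M \<beta>\<^sub>M :: "'m \<Rightarrow> 'm"
  assumes lact_bilinear: "(\<triangleright>) \<in> bilinear_maps K A M M"
    and ract_bilinear: "(\<triangleleft>) \<in> bilinear_maps K M A M"
    and alphaM_linear: "\<alpha>\<^sub>M \<in> linear_maps K M M"
    and betaM_linear: "\<beta>\<^sub>M \<in> linear_maps K M M"
    and alphaM_betaM: "\<forall>m\<in>carrier M. \<alpha>\<^sub>M (\<beta>\<^sub>M m) = \<beta>\<^sub>M (\<alpha>\<^sub>M m)"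
    and alphaM_lact: "\<forall>a\<in>carrier A. \<forall>m\<in>carrier M. \<alpha>\<^sub>M (a \<triangleright> m) = \<alpha>\<^sub>A a \<triangleright> \<alpha>\<^sub>M m"
    and betaM_lact: "\<forall>a\<in>carrier A. \<forall>m\<in>carrier M. \<beta>\<^sub>M (a \<triangleright> m) = \<beta>\<^sub>A a \<triangleright> \<beta>\<^sub>M m"
    and alphaM_ract: "\<forall>a\<in>carrier A. \<forall>m\<in>carrier M. \<alpha>\<^sub>M (m \<triangleleft> a) = \<alpha>\<^sub>M m \<triangleleft> \<alpha>\<^sub>A a"
    and betaM_ract: "\<forall>a\<in>carrier A. \<forall>m\<in>carrier M. \<beta>\<^sub>M (m \<triangleleft> a) = \<beta>\<^sub>M m \<triangleleft> \<beta>\<^sub>A a"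
    and lact_assoc: "\<forall>a\<in>carrier A. \<forall>a'\<in>carrier A. \<forall>m\<in>carrier M.
      \<alpha>\<^sub>A a \<triangleright> (a' \<triangleright> m) = (a \<bullet> a') \<triangleright> \<beta>\<^sub>M m"
    and ract_assoc: "\<forall>a\<in>carrier A. \<forall>a'\<in>carrier A. \<forall>m\<in>carrier M.
      \<alpha>\<^sub>M m \<triangleleft> (a \<bullet> a') = (m \<triangleleft> a) \<triangleleft> \<beta>\<^sub>A a'"
    and lact_ract: "\<forall>a\<in>carrier A. \<forall>a'\<in>carrier A. \<forall>m\<in>carrier M.
      \<alpha>\<^sub>A a \<triangleright> (m \<triangleleft> a') = (a \<triangleright> m) \<triangleleft> \<beta>\<^sub>A a'"

locale bihom_bicomodule =
  bihom_coassoc_coalgebra K A \<Delta> \<psi>\<^sub>A \<omega>\<^sub>A + M: module K M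
  for K :: "('k, 'x) ring_scheme" and A :: "('k, 'a, 'y) module_scheme"
    and \<Delta> :: "'a \<Rightarrow> ('a \<times> 'a \<Rightarrow>\<^sub>0 int) set"
    and \<psi>\<^sub>A \<omega>\<^sub>A :: "'a \<Rightarrow> 'a"
    and M :: "('k, 'm, 'z) module_scheme" +
  fixes \<rho> :: "'m \<Rightarrow> ('a \<times> 'm \<Rightarrow>\<^sub>0 int) set"
    and \<phi> :: "'m \<Rightarrow> ('m \<times> 'a \<Rightarrow>\<^sub>0 int) set"
    and \<psi>\<^sub>M \<omega>\<^sub>M :: "'m \<Rightarrow> 'm"
  assumes rho_linear: "\<rho> \<in> linear_maps K M (tensor K A M)"
    and phi_linear: "\<phi> \<in> linear_maps K M (tensor K M A)"
    and psiM_linear: "\<psi>\<^sub>M \<in> linear_maps K M M"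
    and omegaM_linear: "\<omega>\<^sub>M \<in> linear_maps K M M"
    and psiM_omegaM: "\<forall>m\<in>carrier M. \<psi>\<^sub>M (\<omega>\<^sub>M m) = \<omega>\<^sub>M (\<psi>\<^sub>M m)"
    and psiM_rho: "\<forall>m\<in>carrier M. tensor_map K A M \<psi>\<^sub>A \<psi>\<^sub>M (\<rho> m) = \<rho> (\<psi>\<^sub>M m)"
    and omegaM_rho: "\<forall>m\<in>carrier M. tensor_map K A M \<omega>\<^sub>A \<omega>\<^sub>M (\<rho> m) = \<rho> (\<omega>\<^sub>M m)"
    and psiM_phi: "\<forall>m\<in>carrier M. tensor_map K M A \<psi>\<^sub>M \<psi>\<^sub>A (\<phi> m) = \<phi> (\<psi>\<^sub>M m)"
    and omegaM_phi: "\<forall>m\<in>carrier M. tensor_map K M A \<omega>\<^sub>M \<omega>\<^sub>A (\<phi> m) = \<phi> (\<omega>\<^sub>M m)"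
    and rho_coassoc: "\<forall>m\<in>carrier M.
      tensor_map K A (tensor K A M) \<omega>\<^sub>A \<rho> (\<rho> m) =
      tensor_assoc K A A M (tensor_map K (tensor K A A) M \<Delta> \<psi>\<^sub>M (\<rho> m))"
    and phi_coassoc: "\<forall>m\<in>carrier M.
      tensor_map K M (tensor K A A) \<omega>\<^sub>M \<Delta> (\<phi> m) =
      tensor_assoc K M A A (tensor_map K (tensor K M A) A \<phi> \<psi>\<^sub>A (\<phi> m))"
    and rho_phi: "\<forall>m\<in>carrier M.
      tensor_map K A (tensor K M A) \<omega>\<^sub>A \<phi> (\<rho> m) =
      tensor_assoc K A M A (tensor_map K (tensor K A M) A \<rho> \<psi>\<^sub>A (\<phi> m))"

locale infBH_Hopf_bimodule =
  infBH_bialgebra K lam A mult_A \<Delta> \<alpha>\<^sub>A \<beta>\<^sub>A \<psi>\<^sub>A \<omega>\<^sub>A +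
  bihom_bimodule K A mult_A \<alpha>\<^sub>A \<beta>\<^sub>A M lact ract \<alpha>\<^sub>M \<beta>\<^sub>M +
  bihom_bicomodule K A \<Delta> \<psi>\<^sub>A \<omega>\<^sub>A M \<rho> \<phi> \<psi>\<^sub>M \<omega>\<^sub>M
  for K :: "('k, 'x) ring_scheme" and lam :: 'k and A :: "('k, 'a, 'y) module_scheme"
    and mult_A :: "'a \<Rightarrow> 'a \<Rightarrow> 'a"  (infixl \<open>\<bullet>\<close> 70)
    and \<Delta> :: "'a \<Rightarrow> ('a \<times> 'a \<Rightarrow>\<^sub>0 int) set"
    and \<alpha>\<^sub>A \<beta>\<^sub>A \<psi>\<^sub>A \<omega>\<^sub>A :: "'a \<Rightarrow> 'a"
    and M :: "('k, 'm, 'z) module_scheme"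
    and lact :: "'a \<Rightarrow> 'm \<Rightarrow> 'm"  (infixr \<open>\<triangleright>\<close> 70)
    and ract :: "'m \<Rightarrow> 'a \<Rightarrow> 'm"  (infixl \<open>\<triangleleft>\<close> 70)
    and \<rho> :: "'m \<Rightarrow> ('a \<times> 'm \<Rightarrow>\<^sub>0 int) set"
    and \<phi> :: "'m \<Rightarrow> ('m \<times> 'a \<Rightarrow>\<^sub>0 int) set"
    and \<alpha>\<^sub>M \<beta>\<^sub>M \<psi>\<^sub>M \<omega>\<^sub>M :: "'m \<Rightarrow> 'm" +
  assumes alphaM_psiM: "\<forall>m\<in>carrier M. \<alpha>\<^sub>M (\<psi>\<^sub>M m) = \<psi>\<^sub>M (\<alpha>\<^sub>M m)"
    and alphaM_omegaM: "\<forall>m\<in>carrier M. \<alpha>\<^sub>M (\<omega>\<^sub>M m) = \<omega>\<^sub>M (\<alpha>\<^sub>M m)"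
    and betaM_psiM: "\<forall>m\<in>carrier M. \<beta>\<^sub>M (\<psi>\<^sub>M m) = \<psi>\<^sub>M (\<beta>\<^sub>M m)"
    and betaM_omegaM: "\<forall>m\<in>carrier M. \<beta>\<^sub>M (\<omega>\<^sub>M m) = \<omega>\<^sub>M (\<beta>\<^sub>M m)"
    and rho_lact: "\<forall>a\<in>carrier A. \<forall>m\<in>carrier M.
      \<rho> (a \<triangleright> m) =
        tensor_map K A M (\<lambda>x. \<omega>\<^sub>A a \<bullet> x) \<beta>\<^sub>M (\<rho> m)
        \<oplus>\<^bsub>tensor K A M\<^esub> tensor_map K A M \<alpha>\<^sub>A (\<lambda>x. x \<triangleright> \<psi>\<^sub>M m) (\<Delta> a)
        \<oplus>\<^bsub>tensor K A M\<^esub> lam \<odot>\<^bsub>tensor K A M\<^esub>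
             pure_tensor K A M (\<alpha>\<^sub>A (\<omega>\<^sub>A a)) (\<beta>\<^sub>M (\<psi>\<^sub>M m))"
    and phi_ract: "\<forall>a\<in>carrier A. \<forall>m\<in>carrier M.
      \<phi> (m \<triangleleft> a) =
        tensor_map K M A (\<lambda>x. \<omega>\<^sub>M m \<triangleleft> x) \<beta>\<^sub>A (\<Delta> a)
        \<oplus>\<^bsub>tensor K M A\<^esub> tensor_map K M A \<alpha>\<^sub>M (\<lambda>x. x \<bullet> \<psi>\<^sub>A a) (\<phi> m)
        \<oplus>\<^bsub>tensor K M A\<^esub> lam \<odot>\<^bsub>tensor K M A\<^esub>
             pure_tensor K M A (\<alpha>\<^sub>M (\<omega>\<^sub>M m)) (\<beta>\<^sub>A (\<psi>\<^sub>A a))"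
    and phi_lact: "\<forall>a\<in>carrier A. \<forall>m\<in>carrier M.
      \<phi> (a \<triangleright> m) = tensor_map K M A (\<lambda>x. \<omega>\<^sub>A a \<triangleright> x) \<beta>\<^sub>A (\<phi> m)"
    and rho_ract: "\<forall>a\<in>carrier A. \<forall>m\<in>carrier M.
      \<rho> (m \<triangleleft> a) = tensor_map K A M \<alpha>\<^sub>A (\<lambda>x. x \<triangleleft> \<psi>\<^sub>A a) (\<rho> m)"

definition inf_Hopf_bimodule ::
  "('k, 'x) ring_scheme \<Rightarrow> 'k \<Rightarrow> ('k, 'a, 'y) module_scheme \<Rightarrow> ('a \<Rightarrow> 'a \<Rightarrow> 'a) \<Rightarrow>
   ('a \<Rightarrow> ('a \<times> 'a \<Rightarrow>\<^sub>0 int) set) \<Rightarrow> ('k, 'm, 'z) module_scheme \<Rightarrow>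
   ('a \<Rightarrow> 'm \<Rightarrow> 'm) \<Rightarrow> ('m \<Rightarrow> 'a \<Rightarrow> 'm) \<Rightarrow>
   ('m \<Rightarrow> ('a \<times> 'm \<Rightarrow>\<^sub>0 int) set) \<Rightarrow> ('m \<Rightarrow> ('m \<times> 'a \<Rightarrow>\<^sub>0 int) set) \<Rightarrow> bool"
  where "inf_Hopf_bimodule K lam A mult_A \<Delta> M lact ract \<rho> \<phi> \<longleftrightarrow>
    infBH_Hopf_bimodule K lam A mult_A \<Delta> id id id id M lact ract \<rho> \<phi> id id id id"

end

theory Submission
  imports Defs
begin

text \<open>
  Linear maps out of a tensor product are determined by their values on pure tensors; this makes
  \<open>f \<otimes> g\<close> functorial and the associativity isomorphism natural.  By functoriality both sides of every
  twisted axiom are the image of the two sides of the untwisted axiom under a tensor product of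
  composites of the structure maps: multiplicativity, comultiplicativity and commutation move all
  structure maps to the outside.
\<close>

section \<open>Linear maps\<close>

text \<open>The maps that end up outside are explicit. In every coassociativity-type axiom they are
  \<omega>\<omega> on the left slot, \<omega>\<psi> on the middle and \<psi>\<psi> on the right, in
  both bracketings; one side produces \<psi>\<omega> in the middle, and this is where commutation
  closes the gap. In every product rule the outside map is \<omega> \<otimes> \<psi>, while \<alpha>
  enters through the first argument and \<beta> through the second, each passing through the
  coproduct or coaction there. Two obstacles shape the proof. Tensors are cosets, and both scalar
  action and lift are defined through all representatives at once, so independence of the
  representative comes before any computation with pure tensors. Moreover, structure maps commute
  only on carriers, so their equations cannot simply be rewritten inside a tensor product of maps;
  they have to go through a congruence principle. The axioms of one family differ only in which
  slots hold \<open>A\<close> and which hold \<open>M\<close>. Hence each family is one statement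
  with modules and maps as parameters, and the bialgebra is the case with \<open>A\<close> in every
  slot.\<close>

lemma linear_mapsI:
  assumes "\<And>x. x \<in> carrier V \<Longrightarrow> f x \<in> carrier W"
    and "\<And>x y. x \<in> carrier V \<Longrightarrow> y \<in> carrier V \<Longrightarrow> f (x \<oplus>\<^bsub>V\<^esub> y) = f x \<oplus>\<^bsub>W\<^esub> f y"
    and "\<And>c x. c \<in> carrier K \<Longrightarrow> x \<in> carrier V \<Longrightarrow> f (c \<odot>\<^bsub>V\<^esub> x) = c \<odot>\<^bsub>W\<^esub> f x"
  shows "f \<in> linear_maps K V W"
  using assms by (auto simp: linear_maps_def)

lemma linear_maps_closed: "f \<in> linear_maps K V W \<Longrightarrow> x \<in> carrier V \<Longrightarrow> f x \<in> carrier W"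
  by (auto simp: linear_maps_def)

lemma linear_maps_add:
  "f \<in> linear_maps K V W \<Longrightarrow> x \<in> carrier V \<Longrightarrow> y \<in> carrier V \<Longrightarrow>
   f (x \<oplus>\<^bsub>V\<^esub> y) = f x \<oplus>\<^bsub>W\<^esub> f y"
  by (auto simp: linear_maps_def)

lemma linear_maps_smult:
  "f \<in> linear_maps K V W \<Longrightarrow> c \<in> carrier K \<Longrightarrow> x \<in> carrier V \<Longrightarrow>
   f (c \<odot>\<^bsub>V\<^esub> x) = c \<odot>\<^bsub>W\<^esub> f x"
  by (auto simp: linear_maps_def)

lemma linear_maps_id: "id \<in> linear_maps K V V"
  by (simp add: linear_maps_def)

lemma linear_maps_compose:
  "f \<in> linear_maps K U V \<Longrightarrow> g \<in> linear_maps K V W \<Longrightarrow> (\<lambda>x. g (f x)) \<in> linear_maps K U W"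
  by (auto simp: linear_maps_def Pi_iff)

lemma bilinear_maps_left: "h \<in> bilinear_maps K U V W \<Longrightarrow> u \<in> carrier U \<Longrightarrow> h u \<in> linear_maps K V W"
  by (simp add: bilinear_maps_def)

lemma bilinear_maps_right:
  "h \<in> bilinear_maps K U V W \<Longrightarrow> v \<in> carrier V \<Longrightarrow> (\<lambda>u. h u v) \<in> linear_maps K U W"
  by (simp add: bilinear_maps_def)

lemma bilinear_maps_closed:
  "h \<in> bilinear_maps K U V W \<Longrightarrow> u \<in> carrier U \<Longrightarrow> v \<in> carrier V \<Longrightarrow> h u v \<in> carrier W"
  by (rule linear_maps_closed[OF bilinear_maps_left])

text \<open>Serves twice: for the twisted product and actions, and for the map
  \<open>f v \<otimes> g w\<close> from which \<open>tensor_map\<close> is lifted.\<close>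

lemma bilinear_maps_compose:
  assumes "f \<in> linear_maps K U U'" "g \<in> linear_maps K V V'" "h \<in> bilinear_maps K U' V' W"
  shows "(\<lambda>u v. h (f u) (g v)) \<in> bilinear_maps K U V W"
  unfolding bilinear_maps_def
proof (intro CollectI conjI ballI)
  fix u assume "u \<in> carrier U"
  then show "(\<lambda>v. h (f u) (g v)) \<in> linear_maps K V W"
    using linear_maps_compose[OF assms(2) bilinear_maps_left[OF assms(3)]] linear_maps_closed[OF assms(1)]
    by blast
next
  fix v assume "v \<in> carrier V"
  then show "(\<lambda>u. h (f u) (g v)) \<in> linear_maps K U W"
    using linear_maps_compose[OF assms(1) bilinear_maps_right[OF assms(3)]] linear_maps_closed[OF assms(2)]
    by blast
qed

lemma linear_maps_hom:
  "f \<in> linear_maps K V W \<Longrightarrow> f \<in> hom (add_monoid V) (add_monoid W)"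
  by (auto simp: linear_maps_def hom_def)

lemma linear_maps_zero:
  assumes "module K V" "module K W" "f \<in> linear_maps K V W"
  shows "f \<zero>\<^bsub>V\<^esub> = \<zero>\<^bsub>W\<^esub>"
proof -
  interpret V: module K V by fact
  interpret W: module K W by fact
  show ?thesis
    using hom_one[OF linear_maps_hom[OF assms(3)] V.M.a_group W.M.a_group] by simp
qed

text \<open>Differences matter because induction over a tensor product has a difference
  step.\<close>

lemma linear_maps_minus:
  assumes "module K V" "module K W" "f \<in> linear_maps K V W" "x \<in> carrier V" "y \<in> carrier V"
  shows "f (x \<ominus>\<^bsub>V\<^esub> y) = f x \<ominus>\<^bsub>W\<^esub> f y"
proof -
  interpret V: module K V by fact
  interpret W: module K W by fact
  interpret f: group_hom "add_monoid V" "add_monoid W" f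
    by (simp add: group_hom_def group_hom_axioms_def linear_maps_hom[OF assms(3)]
        V.M.a_group W.M.a_group)
  show ?thesis
    using f.hom_inv[of y] assms
    by (simp add: a_minus_def a_inv_def linear_maps_add[OF assms(3)] V.M.add.inv_closed[unfolded a_inv_def])
qed

text \<open>Allows the right-hand side of an additivity law in a parameter to be treated as a linear
  map in the remaining variable, so that it can be compared on pure tensors. The next lemma does the
  same for homogeneity.\<close>

lemma linear_maps_sum:
  assumes "module K W" "f \<in> linear_maps K V W" "g \<in> linear_maps K V W"
  shows "(\<lambda>x. f x \<oplus>\<^bsub>W\<^esub> g x) \<in> linear_maps K V W"
proof -
  interpret W: module K W by fact
  note cl = linear_maps_closed[OF assms(2)] linear_maps_closed[OF assms(3)]
  show ?thesis
    by (rule linear_mapsI)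
      (simp_all add: cl linear_maps_add[OF assms(2)] linear_maps_add[OF assms(3)]
        linear_maps_smult[OF assms(2)] linear_maps_smult[OF assms(3)] W.smult_r_distr W.M.a_ac)
qed

text \<open>Scaling by \<open>c\<close> is itself linear because \<open>K\<close> is
  commutative.\<close>

lemma linear_maps_scale:
  assumes "module K W" "c \<in> carrier K" "f \<in> linear_maps K V W"
  shows "(\<lambda>x. c \<odot>\<^bsub>W\<^esub> f x) \<in> linear_maps K V W"
proof -
  interpret W: module K W by fact
  note cl = linear_maps_closed[OF assms(3)]
  show ?thesis
    by (rule linear_mapsI)
      (simp_all add: cl assms(2) linear_maps_add[OF assms(3)]
        linear_maps_smult[OF assms(3)] W.smult_r_distr W.R.m_comm flip: W.smult_assoc1)
qed

section \<open>Tensor products\<close>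

text \<open>The expression under \<open>the_elem\<close> in \<open>tensor_lift\<close>: the
  extension of \<open>h\<close> to the free abelian group, before passing to cosets.\<close>

definition frag_eval ::
  "('k, 'p, 'z) module_scheme \<Rightarrow> ('v \<Rightarrow> 'w \<Rightarrow> 'p) \<Rightarrow> ('v \<times> 'w \<Rightarrow>\<^sub>0 int) \<Rightarrow> 'p"
  where "frag_eval P h x =
    (\<Oplus>\<^bsub>P\<^esub>p\<in>Poly_Mapping.keys x. [Poly_Mapping.lookup x p] \<cdot>\<^bsub>P\<^esub> h (fst p) (snd p))"

section \<open>The quotient group and its pure tensors\<close>

locale tensor_product = V: module K V + W: module K W
  for K :: "('k, 'x) ring_scheme" and V :: "('k, 'v, 'y) module_scheme"
    and W :: "('k, 'w, 'z) module_scheme"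
begin

abbreviation "F \<equiv> tensor_free V W"
abbreviation "N \<equiv> tensor_kernel K V W"
abbreviation "T \<equiv> tensor K V W"
abbreviation "cls \<equiv> tensor_class K V W"

lemma carrier_F: "x \<in> carrier F \<longleftrightarrow> Poly_Mapping.keys x \<subseteq> carrier V \<times> carrier W"
  by (simp add: tensor_free_def)

lemma comm_group_F: "comm_group F"
  by (simp add: tensor_free_def abelian_free_Abelian_group)

lemma F_simps [simp]: "x \<otimes>\<^bsub>F\<^esub> y = x + y" "\<one>\<^bsub>F\<^esub> = 0"
  by (simp_all add: tensor_free_def)

lemma inv_F [simp]: "x \<in> carrier F \<Longrightarrow> inv\<^bsub>F\<^esub> x = - x"
  by (simp add: tensor_free_def)

lemma F_closed:
  "0 \<in> carrier F"
  "x \<in> carrier F \<Longrightarrow> y \<in> carrier F \<Longrightarrow> x + y \<in> carrier F"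
  "x \<in> carrier F \<Longrightarrow> y \<in> carrier F \<Longrightarrow> x - y \<in> carrier F"
  "v \<in> carrier V \<Longrightarrow> w \<in> carrier W \<Longrightarrow> frag_of (v, w) \<in> carrier F"
  unfolding carrier_F using keys_add[of x y] keys_diff[of x y] by auto

lemma F_induct [consumes 1, case_names zero diff pure]:
  assumes "x \<in> carrier F" "P 0"
    and "\<And>x y. x \<in> carrier F \<Longrightarrow> y \<in> carrier F \<Longrightarrow> P x \<Longrightarrow> P y \<Longrightarrow> P (x - y)"
    and "\<And>v w. v \<in> carrier V \<Longrightarrow> w \<in> carrier W \<Longrightarrow> P (frag_of (v, w))"
  shows "P x"
  by (rule free_Abelian_group_induct[of x "carrier V \<times> carrier W" P])
    (use assms in \<open>auto simp: carrier_F\<close>)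

lemma relations_closed: "tensor_relations K V W \<subseteq> carrier F"
  unfolding tensor_relations_def by (auto intro!: F_closed)

lemma subgroup_N: "subgroup N F"
  unfolding tensor_kernel_def
  by (rule group.generate_is_subgroup[OF comm_group.axioms(2)[OF comm_group_F] relations_closed])

lemma normal_N: "N \<lhd> F"
  by (rule comm_group.normal_iff_subgroup[OF comm_group_F, THEN iffD2, OF subgroup_N])

text \<open>The kernel of \<open>f\<close> is a subgroup containing the relations, hence contains
  the subgroup they generate. This is the only way in which maps are shown to descend to the
  quotient: it is applied to the scalar action and to the evaluation of a bilinear map.\<close>

lemma hom_kills_N:
  assumes "group G" "f \<in> hom F G" "\<And>r. r \<in> tensor_relations K V W \<Longrightarrow> f r = \<one>\<^bsub>G\<^esub>" "x \<in> N"
  shows "f x = \<one>\<^bsub>G\<^esub>"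
proof -
  interpret f: group_hom F G f
    using assms comm_group.axioms(2)[OF comm_group_F] by (simp add: group_hom_def group_hom_axioms_def)
  have "N \<subseteq> kernel F G f"
    unfolding tensor_kernel_def
    by (rule f.G.generate_subgroup_incl[OF _ f.subgroup_kernel])
      (use assms(3) relations_closed in \<open>auto simp: kernel_def\<close>)
  then show ?thesis
    using assms(4) by (auto simp: kernel_def)
qed

lemma cls_eq_iff: "x \<in> carrier F \<Longrightarrow> y \<in> carrier F \<Longrightarrow> cls x = cls y \<longleftrightarrow> x - y \<in> N"
proof -
  assume xy: "x \<in> carrier F" "y \<in> carrier F"
  interpret F: comm_group F by (rule comm_group_F)
  have "x \<in> cls y \<longleftrightarrow> x - y \<in> N"
    unfolding tensor_class_def
    using subgroup.rcos_module[OF subgroup_N F.is_group xy(2,1)] xy by simp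
  moreover have "x \<in> cls y \<longleftrightarrow> cls x = cls y"
    unfolding tensor_class_def
    using F.repr_independence[OF _ xy(2) subgroup_N] F.rcos_self[OF xy(1) subgroup_N] by metis
  ultimately show ?thesis by simp
qed

lemma mem_cls: "x \<in> carrier F \<Longrightarrow> y \<in> cls x \<longleftrightarrow> y \<in> carrier F \<and> cls y = cls x"
proof -
  assume x: "x \<in> carrier F"
  interpret F: comm_group F by (rule comm_group_F)
  show ?thesis
    unfolding tensor_class_def
    using F.repr_independence[OF _ x subgroup_N] F.rcos_self[OF _ subgroup_N]
      subgroup.elemrcos_carrier[OF subgroup_N F.is_group x] by metis
qed

lemma carrier_tensor: "carrier T = cls ` carrier F"
  by (auto simp: tensor_def Let_def carrier_FactGroup tensor_class_def)

lemma tensor_add: "x \<in> carrier F \<Longrightarrow> y \<in> carrier F \<Longrightarrow> cls x \<oplus>\<^bsub>T\<^esub> cls y = cls (x + y)"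
  using normal.rcos_sum[OF normal_N] by (simp add: tensor_def Let_def tensor_class_def)

lemma tensor_zero: "\<zero>\<^bsub>T\<^esub> = cls 0"
proof -
  interpret F: comm_group F by (rule comm_group_F)
  show ?thesis
    using F.coset_mult_one[of N] subgroup.subset[OF subgroup_N]
    by (simp add: tensor_def Let_def tensor_class_def)
qed

lemma abelian_group_tensor: "abelian_group T"
proof -
  interpret Q: comm_group "F Mod N"
    by (rule comm_group.abelian_FactGroup[OF comm_group_F subgroup_N])
  have [simp]: "carrier T = carrier (F Mod N)" "\<zero>\<^bsub>T\<^esub> = \<one>\<^bsub>F Mod N\<^esub>"
    "x \<oplus>\<^bsub>T\<^esub> y = x \<otimes>\<^bsub>F Mod N\<^esub> y" for x y
    by (simp_all add: tensor_def Let_def)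
  show ?thesis
    using Q.l_inv_ex
    by (intro abelian_groupI)
      (simp_all del: one_FactGroup mult_FactGroup add: Q.m_ac)
qed

lemma cls_diff: "x \<in> carrier F \<Longrightarrow> y \<in> carrier F \<Longrightarrow> cls (x - y) = cls x \<ominus>\<^bsub>T\<^esub> cls y"
proof -
  assume xy: "x \<in> carrier F" "y \<in> carrier F"
  interpret T: abelian_group T by (rule abelian_group_tensor)
  have "cls (x - y) \<oplus>\<^bsub>T\<^esub> cls y = cls x"
    using xy by (simp add: tensor_add F_closed)
  moreover have "cls (x - y) \<in> carrier T" "cls y \<in> carrier T"
    using xy by (auto simp: carrier_tensor F_closed)
  ultimately show ?thesis
    by (metis T.minus_eq T.a_assoc T.a_inv_closed T.r_neg T.r_zero)
qed

lemma pure_tensor_closed: "v \<in> carrier V \<Longrightarrow> w \<in> carrier W \<Longrightarrow> pure_tensor K V W v w \<in> carrier T"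
  by (simp add: pure_tensor_def carrier_tensor F_closed)

lemma pure_tensor_add_left:
  assumes "v \<in> carrier V" "v' \<in> carrier V" "w \<in> carrier W"
  shows "pure_tensor K V W (v \<oplus>\<^bsub>V\<^esub> v') w = pure_tensor K V W v w \<oplus>\<^bsub>T\<^esub> pure_tensor K V W v' w"
proof -
  have "frag_of (v \<oplus>\<^bsub>V\<^esub> v', w) - frag_of (v, w) - frag_of (v', w) \<in> N"
    unfolding tensor_kernel_def
    by (rule generate.incl) (use assms in \<open>auto simp: tensor_relations_def\<close>)
  then show ?thesis
    using assms by (simp add: pure_tensor_def tensor_add F_closed cls_eq_iff diff_diff_eq)
qed

lemma pure_tensor_add_right:
  assumes "v \<in> carrier V" "w \<in> carrier W" "w' \<in> carrier W"
  shows "pure_tensor K V W v (w \<oplus>\<^bsub>W\<^esub> w') = pure_tensor K V W v w \<oplus>\<^bsub>T\<^esub> pure_tensor K V W v w'"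
proof -
  have "frag_of (v, w \<oplus>\<^bsub>W\<^esub> w') - frag_of (v, w) - frag_of (v, w') \<in> N"
    unfolding tensor_kernel_def
    by (rule generate.incl) (use assms in \<open>auto simp: tensor_relations_def\<close>)
  then show ?thesis
    using assms by (simp add: pure_tensor_def tensor_add F_closed cls_eq_iff diff_diff_eq)
qed

lemma pure_tensor_balanced:
  assumes "c \<in> carrier K" "v \<in> carrier V" "w \<in> carrier W"
  shows "pure_tensor K V W (c \<odot>\<^bsub>V\<^esub> v) w = pure_tensor K V W v (c \<odot>\<^bsub>W\<^esub> w)"
proof -
  have "frag_of (c \<odot>\<^bsub>V\<^esub> v, w) - frag_of (v, c \<odot>\<^bsub>W\<^esub> w) \<in> N"
    unfolding tensor_kernel_def
    by (rule generate.incl) (use assms in \<open>auto simp: tensor_relations_def\<close>)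
  then show ?thesis
    using assms by (simp add: pure_tensor_def F_closed cls_eq_iff)
qed

section \<open>The scalar action and the module structure\<close>

definition scale where "scale c = frag_extend (\<lambda>(v, w). frag_of (c \<odot>\<^bsub>V\<^esub> v, w))"

lemma scale_simps: "scale c (x - y) = scale c x - scale c y" "scale c (x + y) = scale c x + scale c y"
  "scale c 0 = 0" "scale c (frag_of (v, w)) = frag_of (c \<odot>\<^bsub>V\<^esub> v, w)"
  by (simp_all add: scale_def frag_extend_diff frag_extend_add)

lemma scale_closed: "c \<in> carrier K \<Longrightarrow> x \<in> carrier F \<Longrightarrow> scale c x \<in> carrier F"
  by (rotate_tac, induction rule: F_induct) (auto simp: scale_simps F_closed)

text \<open>Scaling the left entry turns each of the three kinds of relation into one of the same
  kind, with \<open>c \<odot> v\<close> in place of \<open>v\<close>; the balancing relation uses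
  commutativity of \<open>K\<close> to exchange \<open>c\<close> and \<open>d\<close>.\<close>

lemma scale_N:
  assumes c: "c \<in> carrier K" and x: "x \<in> N"
  shows "scale c x \<in> N"
proof -
  interpret T: abelian_group T by (rule abelian_group_tensor)
  have "cls (scale c x) = \<one>\<^bsub>add_monoid T\<^esub>"
  proof (rule hom_kills_N[OF T.a_group _ _ x, of "\<lambda>x. cls (scale c x)"])
    show "(\<lambda>x. cls (scale c x)) \<in> hom F (add_monoid T)"
      using c by (auto simp: hom_def scale_closed scale_simps tensor_add carrier_tensor)
    fix r assume "r \<in> tensor_relations K V W"
    then have "cls (scale c r) = cls 0"
      unfolding tensor_relations_def
    proof (elim UnE CollectE exE conjE, goal_cases)
      case (1 v v' w)
      then show ?thesis
        using c pure_tensor_add_left[of "c \<odot>\<^bsub>V\<^esub> v" "c \<odot>\<^bsub>V\<^esub> v'" w]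
        by (simp add: scale_simps F_closed V.smult_r_distr cls_eq_iff diff_diff_eq pure_tensor_def tensor_add)
    next
      case (2 v w w')
      then show ?thesis
        using c pure_tensor_add_right[of "c \<odot>\<^bsub>V\<^esub> v" w w']
        by (simp add: scale_simps F_closed cls_eq_iff diff_diff_eq pure_tensor_def tensor_add)
    next
      case (3 d v w)
      then show ?thesis
        using c pure_tensor_balanced[of d "c \<odot>\<^bsub>V\<^esub> v" w]
        by (simp add: scale_simps F_closed cls_eq_iff pure_tensor_def V.R.m_comm flip: V.smult_assoc1)
    qed
    then show "cls (scale c r) = \<one>\<^bsub>add_monoid T\<^esub>"
      by (simp add: tensor_zero)
  qed
  moreover have "x \<in> carrier F"
    using x subgroup.subset[OF subgroup_N] by auto
  ultimately show ?thesis
    using cls_eq_iff[of "scale c x" 0] c by (simp add: tensor_zero F_closed scale_closed)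
qed

text \<open>The \<open>smult\<close> field of \<open>tensor\<close> is a union over all
  representatives. By \<open>scale_N\<close> they all yield one and the same coset, so the union of
  this nonempty family is that coset.\<close>

lemma tensor_smult:
  assumes c: "c \<in> carrier K" and x: "x \<in> carrier F"
  shows "c \<odot>\<^bsub>T\<^esub> cls x = cls (scale c x)"
proof -
  have *: "cls (scale c y) = cls (scale c x)" if "y \<in> cls x" for y
  proof -
    have y: "y \<in> carrier F" "cls y = cls x" using that mem_cls[OF x] by auto
    have "scale c (y - x) \<in> N"
      using y x c by (intro scale_N) (simp_all flip: cls_eq_iff)
    then show ?thesis
      using y x c by (simp add: scale_simps cls_eq_iff scale_closed)
  qed
  have "x \<in> cls x" using mem_cls[OF x] x by simp
  then have "(\<Union>y\<in>cls x. cls (scale c y)) = cls (scale c x)"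
    using * by blast
  then show ?thesis
    by (simp add: tensor_def Let_def scale_def)
qed

lemma pure_tensor_smult_left:
  "c \<in> carrier K \<Longrightarrow> v \<in> carrier V \<Longrightarrow> w \<in> carrier W \<Longrightarrow>
   pure_tensor K V W (c \<odot>\<^bsub>V\<^esub> v) w = c \<odot>\<^bsub>T\<^esub> pure_tensor K V W v w"
  by (simp add: pure_tensor_def tensor_smult F_closed scale_simps)

text \<open>No step for scalar multiples is needed, since a multiple of a pure tensor is again pure.
  Taking differences instead of sums also covers negatives.\<close>

lemma tensor_induct [consumes 1, case_names zero diff pure]:
  assumes X: "X \<in> carrier T" and "P \<zero>\<^bsub>T\<^esub>"
    and "\<And>X Y. X \<in> carrier T \<Longrightarrow> Y \<in> carrier T \<Longrightarrow> P X \<Longrightarrow> P Y \<Longrightarrow> P (X \<ominus>\<^bsub>T\<^esub> Y)"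
    and "\<And>v w. v \<in> carrier V \<Longrightarrow> w \<in> carrier W \<Longrightarrow> P (pure_tensor K V W v w)"
  shows "P X"
proof -
  obtain x where x: "x \<in> carrier F" "X = cls x"
    using X by (auto simp: carrier_tensor)
  from x(1) have "P (cls x)"
    by (induction rule: F_induct)
      (use assms(2-) in \<open>auto simp: tensor_zero cls_diff carrier_tensor pure_tensor_def\<close>)
  then show ?thesis by (simp add: x)
qed

text \<open>Distributivity over sums of tensors is read off representatives. The remaining scalar
  laws go by induction: on a pure tensor the scalars act on the left factor, where they become the
  corresponding law of \<open>V\<close>.\<close>

lemma module_tensor: "module K T"
proof -
  interpret T: abelian_group T by (rule abelian_group_tensor)
  have closed: "c \<odot>\<^bsub>T\<^esub> X \<in> carrier T" if "c \<in> carrier K" "X \<in> carrier T" for c X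
    using that by (auto simp: carrier_tensor tensor_smult scale_closed)
  have add: "c \<odot>\<^bsub>T\<^esub> (X \<oplus>\<^bsub>T\<^esub> Y) = c \<odot>\<^bsub>T\<^esub> X \<oplus>\<^bsub>T\<^esub> c \<odot>\<^bsub>T\<^esub> Y"
    if "c \<in> carrier K" "X \<in> carrier T" "Y \<in> carrier T" for c X Y
    using that by (auto simp: carrier_tensor tensor_smult scale_closed tensor_add F_closed scale_simps)
  have zero: "c \<odot>\<^bsub>T\<^esub> \<zero>\<^bsub>T\<^esub> = \<zero>\<^bsub>T\<^esub>" if "c \<in> carrier K" for c
    using that by (simp add: tensor_zero tensor_smult F_closed scale_simps)
  have smdiff: "c \<odot>\<^bsub>T\<^esub> (X \<ominus>\<^bsub>T\<^esub> Y) = c \<odot>\<^bsub>T\<^esub> X \<ominus>\<^bsub>T\<^esub> c \<odot>\<^bsub>T\<^esub> Y"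
    if "c \<in> carrier K" "X \<in> carrier T" "Y \<in> carrier T" for c X Y
    using that by (auto simp: carrier_tensor tensor_smult scale_closed F_closed scale_simps simp flip: cls_diff)
  have rearrange: "(p \<oplus>\<^bsub>T\<^esub> q) \<ominus>\<^bsub>T\<^esub> (r \<oplus>\<^bsub>T\<^esub> s) = (p \<ominus>\<^bsub>T\<^esub> r) \<oplus>\<^bsub>T\<^esub> (q \<ominus>\<^bsub>T\<^esub> s)"
    if "p \<in> carrier T" "q \<in> carrier T" "r \<in> carrier T" "s \<in> carrier T" for p q r s
    using that by (simp add: T.minus_eq T.minus_add T.a_ac)
  show ?thesis
  proof (rule moduleI)
    show "cring K" by (rule V.is_cring)
    show "abelian_group T" by (rule abelian_group_tensor)
    fix a b X assume ab: "a \<in> carrier K" "b \<in> carrier K" and X: "X \<in> carrier T"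
    from X show "(a \<oplus>\<^bsub>K\<^esub> b) \<odot>\<^bsub>T\<^esub> X = a \<odot>\<^bsub>T\<^esub> X \<oplus>\<^bsub>T\<^esub> b \<odot>\<^bsub>T\<^esub> X"
    proof (induction rule: tensor_induct)
      case (diff X Y)
      then show ?case
        using ab by (simp add: smdiff closed rearrange)
    qed (use ab in \<open>simp_all add: zero pure_tensor_add_left V.smult_l_distr flip: pure_tensor_smult_left\<close>)
    from X show "(a \<otimes>\<^bsub>K\<^esub> b) \<odot>\<^bsub>T\<^esub> X = a \<odot>\<^bsub>T\<^esub> (b \<odot>\<^bsub>T\<^esub> X)"
      by (induction rule: tensor_induct)
        (use ab in \<open>simp_all add: zero smdiff closed V.smult_assoc1 flip: pure_tensor_smult_left\<close>)
  next
    fix X assume "X \<in> carrier T"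
    then show "\<one>\<^bsub>K\<^esub> \<odot>\<^bsub>T\<^esub> X = X"
      by (induction rule: tensor_induct)
        (simp_all add: zero smdiff closed flip: pure_tensor_smult_left)
  qed (fact closed add)+
qed

sublocale T: module K T by (rule module_tensor)

text \<open>Scalars act on the left factor by construction; homogeneity in the right factor is
  obtained from the balancing relation.\<close>

lemma pure_tensor_bilinear: "pure_tensor K V W \<in> bilinear_maps K V W T"
  unfolding bilinear_maps_def
  by (auto intro!: linear_mapsI simp: pure_tensor_closed pure_tensor_add_left pure_tensor_add_right
      pure_tensor_smult_left simp flip: pure_tensor_balanced)

section \<open>The universal property\<close>

lemma tensor_linear_eqI:
  assumes P: "module K P" and f: "f \<in> linear_maps K T P" and g: "g \<in> linear_maps K T P"
    and "\<And>v w. v \<in> carrier V \<Longrightarrow> w \<in> carrier W \<Longrightarrow> f (pure_tensor K V W v w) = g (pure_tensor K V W v w)"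
    and X: "X \<in> carrier T"
  shows "f X = g X"
  using X
  by (induction rule: tensor_induct)
    (simp_all add: assms(4) linear_maps_zero[OF module_tensor P f] linear_maps_zero[OF module_tensor P g]
      linear_maps_minus[OF module_tensor P f] linear_maps_minus[OF module_tensor P g])

lemma frag_eval_hom:
  assumes P: "module K P" and h: "h \<in> bilinear_maps K V W P"
  shows "frag_eval P h \<in> hom F (add_monoid P)"
proof -
  interpret P: module K P by fact
  let ?t = "\<lambda>x p. [Poly_Mapping.lookup x p] \<cdot>\<^bsub>P\<^esub> h (fst p) (snd p)"
  have closed: "h (fst p) (snd p) \<in> carrier P" if "x \<in> carrier F" "p \<in> Poly_Mapping.keys x" for x p
    using that bilinear_maps_closed[OF h] by (auto simp: carrier_F)
  have pow_0: "[(0::int)] \<cdot>\<^bsub>P\<^esub> z = \<zero>\<^bsub>P\<^esub>" for z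
    by (simp add: add_pow_def)
  \<comment> \<open>Cancellation can make the support of \<open>x + y\<close> smaller than the union
    of the supports. All three sums are therefore taken over that union, where the additional
    coefficients are 0.\<close>
  have extend: "frag_eval P h x = (\<Oplus>\<^bsub>P\<^esub>p\<in>S. ?t x p)"
    if "finite S" "Poly_Mapping.keys x \<subseteq> S" "S \<subseteq> carrier V \<times> carrier W" for x S
    unfolding frag_eval_def
    by (rule P.M.add.finprod_mono_neutral_cong_left[OF that(1,2)])
      (use that bilinear_maps_closed[OF h] in \<open>auto simp: in_keys_iff pow_0\<close>)
  show ?thesis
  proof (rule homI)
    fix x assume "x \<in> carrier F"
    then show "frag_eval P h x \<in> carrier (add_monoid P)"
      unfolding frag_eval_def using closed by (auto intro!: P.M.finsum_closed)
  next
    fix x y assume xy: "x \<in> carrier F" "y \<in> carrier F"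
    let ?S = "Poly_Mapping.keys x \<union> Poly_Mapping.keys y"
    have S: "finite ?S" "?S \<subseteq> carrier V \<times> carrier W"
      using xy by (auto simp: carrier_F)
    have c: "h (fst p) (snd p) \<in> carrier P" if "p \<in> ?S" for p
      using that xy closed by blast
    have "frag_eval P h (x + y) = (\<Oplus>\<^bsub>P\<^esub>p\<in>?S. ?t (x + y) p)"
      by (rule extend[OF S(1) keys_add S(2)])
    also have "\<dots> = (\<Oplus>\<^bsub>P\<^esub>p\<in>?S. ?t x p \<oplus>\<^bsub>P\<^esub> ?t y p)"
      by (rule P.M.finsum_cong')
        (use c in \<open>auto simp: lookup_add P.M.add.int_pow_mult\<close>)
    also have "\<dots> = (\<Oplus>\<^bsub>P\<^esub>p\<in>?S. ?t x p) \<oplus>\<^bsub>P\<^esub> (\<Oplus>\<^bsub>P\<^esub>p\<in>?S. ?t y p)"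
      using S(1) c by (intro P.M.finsum_addf) auto
    also have "\<dots> = frag_eval P h x \<oplus>\<^bsub>P\<^esub> frag_eval P h y"
      using extend[OF S(1) _ S(2)] by simp
    finally show "frag_eval P h (x \<otimes>\<^bsub>F\<^esub> y) = frag_eval P h x \<otimes>\<^bsub>add_monoid P\<^esub> frag_eval P h y"
      by simp
  qed
qed

lemma frag_eval_frag_of:
  assumes P: "module K P" and "h \<in> bilinear_maps K V W P" "v \<in> carrier V" "w \<in> carrier W"
  shows "frag_eval P h (frag_of (v, w)) = h v w"
proof -
  interpret P: module K P by fact
  show ?thesis
    unfolding frag_eval_def using bilinear_maps_closed[OF assms(2-4)]
    by (simp add: P.M.add.int_pow_1)
qed

lemma frag_eval_diff:
  assumes P: "module K P" and h: "h \<in> bilinear_maps K V W P" and xy: "x \<in> carrier F" "y \<in> carrier F"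
  shows "frag_eval P h (x - y) = frag_eval P h x \<ominus>\<^bsub>P\<^esub> frag_eval P h y"
proof -
  interpret P: module K P by fact
  have "frag_eval P h (x - y) \<oplus>\<^bsub>P\<^esub> frag_eval P h y = frag_eval P h x"
    using hom_mult[OF frag_eval_hom[OF P h], of "x - y" y] xy F_closed(3)[of x y] by simp
  moreover have "frag_eval P h (x - y) \<in> carrier P" "frag_eval P h y \<in> carrier P"
    using hom_in_carrier[OF frag_eval_hom[OF P h]] xy F_closed(3)[of x y] by auto
  ultimately show ?thesis
    by (metis P.M.minus_eq P.M.a_assoc P.M.a_inv_closed P.M.r_neg P.M.r_zero)
qed

text \<open>The three kinds of relation evaluate to zero by additivity of \<open>h\<close> in each
  argument and by its homogeneity in both.\<close>

lemma frag_eval_N: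
  assumes P: "module K P" and h: "h \<in> bilinear_maps K V W P" and "x \<in> N"
  shows "frag_eval P h x = \<zero>\<^bsub>P\<^esub>"
proof -
  interpret P: module K P by fact
  note hl = bilinear_maps_left[OF h] and hr = bilinear_maps_right[OF h]
  note simps = frag_eval_diff[OF P h] frag_eval_frag_of[OF P h] F_closed
    linear_maps_add[OF hl] linear_maps_add[OF hr] linear_maps_smult[OF hl] linear_maps_smult[OF hr]
    bilinear_maps_closed[OF h]
  have "frag_eval P h x = \<one>\<^bsub>add_monoid P\<^esub>"
  proof (rule hom_kills_N[OF P.M.a_group frag_eval_hom[OF P h] _ assms(3)])
    have cancel: "(p \<oplus>\<^bsub>P\<^esub> q) \<ominus>\<^bsub>P\<^esub> p \<ominus>\<^bsub>P\<^esub> q = \<zero>\<^bsub>P\<^esub>" if "p \<in> carrier P" "q \<in> carrier P" for p q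
      using that by (simp add: P.M.minus_eq P.M.a_assoc) (metis P.M.a_comm P.M.a_inv_closed P.M.r_neg2 P.M.r_neg)
    fix r assume "r \<in> tensor_relations K V W"
    then show "frag_eval P h r = \<one>\<^bsub>add_monoid P\<^esub>"
      unfolding tensor_relations_def
    proof (elim UnE CollectE exE conjE, goal_cases)
      case (1 v v' w)
      then show ?case by (simp add: simps cancel)
    next
      case (2 v w w')
      then show ?case by (simp add: simps cancel)
    next
      case (3 d v w)
      then show ?case by (simp add: simps) (simp add: P.M.minus_eq P.M.r_neg simps)
    qed
  qed
  then show ?thesis by simp
qed

text \<open>Two representatives differ by an element of the kernel, on which the evaluation
  vanishes. The image of the coset is thus a singleton, and \<open>the_elem\<close> returns its
  member.\<close>

lemma tensor_lift_cls:
  assumes P: "module K P" and h: "h \<in> bilinear_maps K V W P" and x: "x \<in> carrier F"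
  shows "tensor_lift P h (cls x) = frag_eval P h x"
proof -
  interpret P: module K P by fact
  have "frag_eval P h y = frag_eval P h x" if "y \<in> cls x" for y
  proof -
    have y: "y \<in> carrier F" "y - x \<in> N"
      using that x mem_cls cls_eq_iff by auto
    have "frag_eval P h y = frag_eval P h (y - x) \<oplus>\<^bsub>P\<^esub> frag_eval P h x"
      using hom_mult[OF frag_eval_hom[OF P h], of "y - x" x] y x F_closed(3) by simp
    also have "\<dots> = frag_eval P h x"
      using hom_in_carrier[OF frag_eval_hom[OF P h] x] by (simp add: frag_eval_N[OF P h y(2)])
    finally show ?thesis .
  qed
  moreover have "x \<in> cls x" using mem_cls[OF x] x by simp
  ultimately have "frag_eval P h ` cls x = {frag_eval P h x}" by blast
  moreover have "tensor_lift P h (cls x) = the_elem (frag_eval P h ` cls x)"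
    by (simp add: tensor_lift_def frag_eval_def[abs_def])
  ultimately show ?thesis by simp
qed

lemma tensor_lift_pure:
  assumes "module K P" "h \<in> bilinear_maps K V W P" "v \<in> carrier V" "w \<in> carrier W"
  shows "tensor_lift P h (pure_tensor K V W v w) = h v w"
  unfolding pure_tensor_def using assms by (simp add: tensor_lift_cls F_closed frag_eval_frag_of)

text \<open>Additivity is inherited from the free group. The free group carries no scalar action of
  \<open>K\<close>, so homogeneity is proved by induction, and the pure case is homogeneity of
  \<open>h\<close> in its first argument.\<close>

lemma tensor_lift_linear:
  assumes P: "module K P" and h: "h \<in> bilinear_maps K V W P"
  shows "tensor_lift P h \<in> linear_maps K T P"
proof -
  interpret P: module K P by fact
  note ev = frag_eval_hom[OF P h]
  let ?L = "tensor_lift P h"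
  have closed: "?L X \<in> carrier P" if "X \<in> carrier T" for X
    using that hom_in_carrier[OF ev] by (auto simp: carrier_tensor tensor_lift_cls[OF P h])
  have diff: "?L (X \<ominus>\<^bsub>T\<^esub> Y) = ?L X \<ominus>\<^bsub>P\<^esub> ?L Y" if "X \<in> carrier T" "Y \<in> carrier T" for X Y
    using that by (auto simp: carrier_tensor tensor_lift_cls[OF P h] F_closed frag_eval_diff[OF P h]
        simp flip: cls_diff)
  have zero: "?L \<zero>\<^bsub>T\<^esub> = \<zero>\<^bsub>P\<^esub>"
    using frag_eval_N[OF P h subgroup.one_closed[OF subgroup_N]]
    by (simp add: tensor_zero tensor_lift_cls[OF P h] F_closed)
  show ?thesis
  proof (rule linear_mapsI)
    fix X Y assume "X \<in> carrier T" "Y \<in> carrier T"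
    then obtain x y where xy: "x \<in> carrier F" "y \<in> carrier F" "X = cls x" "Y = cls y"
      by (auto simp: carrier_tensor)
    show "?L (X \<oplus>\<^bsub>T\<^esub> Y) = ?L X \<oplus>\<^bsub>P\<^esub> ?L Y"
      using hom_mult[OF ev xy(1,2)] by (simp add: xy tensor_add tensor_lift_cls[OF P h] F_closed)
  next
    fix c X assume c: "c \<in> carrier K" and X: "X \<in> carrier T"
    from X show "?L (c \<odot>\<^bsub>T\<^esub> X) = c \<odot>\<^bsub>P\<^esub> ?L X"
    proof (induction rule: tensor_induct)
      case (diff X Y)
      have "c \<odot>\<^bsub>T\<^esub> (X \<ominus>\<^bsub>T\<^esub> Y) = c \<odot>\<^bsub>T\<^esub> X \<ominus>\<^bsub>T\<^esub> c \<odot>\<^bsub>T\<^esub> Y"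
        using diff c by (simp add: T.M.minus_eq T.smult_r_distr T.smult_r_minus)
      moreover have "c \<odot>\<^bsub>P\<^esub> (?L X \<ominus>\<^bsub>P\<^esub> ?L Y) = c \<odot>\<^bsub>P\<^esub> ?L X \<ominus>\<^bsub>P\<^esub> c \<odot>\<^bsub>P\<^esub> ?L Y"
        using diff c closed by (simp add: P.M.minus_eq P.smult_r_distr P.smult_r_minus)
      ultimately show ?case
        using diff c by (simp add: \<open>\<And>X Y. X \<in> carrier T \<Longrightarrow> Y \<in> carrier T \<Longrightarrow> ?L (X \<ominus>\<^bsub>T\<^esub> Y) = ?L X \<ominus>\<^bsub>P\<^esub> ?L Y\<close>)
    next
      case (pure v w)
      then show ?case
        using c linear_maps_smult[OF bilinear_maps_right[OF h]]
        by (simp add: tensor_lift_pure[OF P h] flip: pure_tensor_smult_left)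
    qed (use c zero in simp)
  qed (fact closed)
qed

end

section \<open>Tensor products of linear maps\<close>

lemma tensor_map_bilinear:
  assumes "module K V'" "module K W'" "f \<in> linear_maps K V V'" "g \<in> linear_maps K W W'"
  shows "(\<lambda>v w. pure_tensor K V' W' (f v) (g w)) \<in> bilinear_maps K V W (tensor K V' W')"
  using assms
  by (intro bilinear_maps_compose[OF assms(3,4)] tensor_product.pure_tensor_bilinear tensor_product.intro)

lemma tensor_map_pure:
  assumes "module K V" "module K W" "module K V'" "module K W'"
    and "f \<in> linear_maps K V V'" "g \<in> linear_maps K W W'" "v \<in> carrier V" "w \<in> carrier W"
  shows "tensor_map K V' W' f g (pure_tensor K V W v w) = pure_tensor K V' W' (f v) (g w)"
  unfolding tensor_map_def using assms
  by (intro tensor_product.tensor_lift_pure tensor_map_bilinear tensor_product.module_tensor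
      tensor_product.intro)

lemma tensor_map_linear:
  assumes "module K V" "module K W" "module K V'" "module K W'"
    and "f \<in> linear_maps K V V'" "g \<in> linear_maps K W W'"
  shows "tensor_map K V' W' f g \<in> linear_maps K (tensor K V W) (tensor K V' W')"
  unfolding tensor_map_def using assms
  by (intro tensor_product.tensor_lift_linear tensor_map_bilinear tensor_product.module_tensor
      tensor_product.intro)

text \<open>Maps agreeing on the carriers can still be different HOL functions, so equality of their
  tensor products is not a matter of rewriting; it is checked on pure tensors.\<close>

lemma tensor_map_cong:
  assumes V: "module K V" "module K W" "module K V'" "module K W'"
    and fg: "f \<in> linear_maps K V V'" "g \<in> linear_maps K W W'"
    and pq: "p \<in> linear_maps K V V'" "q \<in> linear_maps K W W'"
    and eq: "\<And>v. v \<in> carrier V \<Longrightarrow> f v = p v" "\<And>w. w \<in> carrier W \<Longrightarrow> g w = q w"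
    and X: "X \<in> carrier (tensor K V W)"
  shows "tensor_map K V' W' f g X = tensor_map K V' W' p q X"
proof -
  interpret VW: tensor_product K V W
    using V by (simp add: tensor_product_def)
  interpret V'W': tensor_product K V' W'
    using V by (simp add: tensor_product_def)
  show ?thesis
    by (rule VW.tensor_linear_eqI[OF V'W'.module_tensor tensor_map_linear[OF V fg] tensor_map_linear[OF V pq] _ X])
      (simp add: tensor_map_pure[OF V fg] tensor_map_pure[OF V pq] eq)
qed

lemma tensor_map_compose:
  assumes V: "module K V" "module K W" and V': "module K V'" "module K W'"
    and V'': "module K V''" "module K W''"
    and fg: "f \<in> linear_maps K V V'" "g \<in> linear_maps K W W'"
    and fg': "f' \<in> linear_maps K V' V''" "g' \<in> linear_maps K W' W''"
    and X: "X \<in> carrier (tensor K V W)"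
  shows "tensor_map K V'' W'' f' g' (tensor_map K V' W' f g X) =
    tensor_map K V'' W'' (\<lambda>v. f' (f v)) (\<lambda>w. g' (g w)) X"
proof -
  interpret VW: tensor_product K V W
    using V by (simp add: tensor_product_def)
  interpret V''W'': tensor_product K V'' W''
    using V'' by (simp add: tensor_product_def)
  note comp = linear_maps_compose[OF fg(1) fg'(1)] linear_maps_compose[OF fg(2) fg'(2)]
  show ?thesis
    by (rule VW.tensor_linear_eqI[OF V''W''.module_tensor
          linear_maps_compose[OF tensor_map_linear[OF V V' fg] tensor_map_linear[OF V' V'' fg']]
          tensor_map_linear[OF V V'' comp] _ X])
      (simp add: tensor_map_pure[OF V V' fg] tensor_map_pure[OF V' V'' fg'] tensor_map_pure[OF V V'' comp]
        linear_maps_closed[OF fg(1)] linear_maps_closed[OF fg(2)])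
qed

text \<open>A commuting square in each factor gives a commuting square of tensor products. The two
  routes may pass through different intermediate modules, as is needed when a coproduct or an action
  is one of the maps.\<close>

lemma tensor_map_compose_eq:
  assumes V: "module K V" "module K W" and V\<^sub>1: "module K V\<^sub>1" "module K W\<^sub>1"
    and V\<^sub>2: "module K V\<^sub>2" "module K W\<^sub>2" and V': "module K V'" "module K W'"
    and fg: "f \<in> linear_maps K V V\<^sub>1" "g \<in> linear_maps K W W\<^sub>1"
    and fg': "f' \<in> linear_maps K V\<^sub>1 V'" "g' \<in> linear_maps K W\<^sub>1 W'"
    and pq: "p \<in> linear_maps K V V\<^sub>2" "q \<in> linear_maps K W W\<^sub>2"
    and pq': "p' \<in> linear_maps K V\<^sub>2 V'" "q' \<in> linear_maps K W\<^sub>2 W'"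
    and eq: "\<And>v. v \<in> carrier V \<Longrightarrow> f' (f v) = p' (p v)" "\<And>w. w \<in> carrier W \<Longrightarrow> g' (g w) = q' (q w)"
    and X: "X \<in> carrier (tensor K V W)"
  shows "tensor_map K V' W' f' g' (tensor_map K V\<^sub>1 W\<^sub>1 f g X) =
    tensor_map K V' W' p' q' (tensor_map K V\<^sub>2 W\<^sub>2 p q X)"
  unfolding tensor_map_compose[OF V V\<^sub>1 V' fg fg' X] tensor_map_compose[OF V V\<^sub>2 V' pq pq' X]
  by (rule tensor_map_cong[OF V V' linear_maps_compose[OF fg(1) fg'(1)] linear_maps_compose[OF fg(2) fg'(2)]
        linear_maps_compose[OF pq(1) pq'(1)] linear_maps_compose[OF pq(2) pq'(2)] eq X])

lemma module_tensor: "module K V \<Longrightarrow> module K W \<Longrightarrow> module K (tensor K V W)"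
  by (simp add: tensor_product.module_tensor tensor_product_def)

section \<open>The associativity isomorphism\<close>

locale tensor_triple = U: module K U + V: module K V + W: module K W
  for K :: "('k, 'x) ring_scheme" and U :: "('k, 'u, 't) module_scheme"
    and V :: "('k, 'v, 'y) module_scheme" and W :: "('k, 'w, 'z) module_scheme"
begin

sublocale UV: tensor_product K U V ..
sublocale VW: tensor_product K V W ..
sublocale U_VW: tensor_product K U "tensor K V W" ..
sublocale UV_W: tensor_product K "tensor K U V" W ..

text \<open>The two nested stages of \<open>tensor_assoc\<close>: with \<open>w\<close> held fixed,
  \<open>assoc_inner\<close> is lifted over the product of \<open>U\<close> and \<open>V\<close>;
  the resulting function \<open>assoc_outer\<close> of a tensor and \<open>w\<close> is then lifted
  once more.\<close>

abbreviation "assoc_inner w \<equiv> \<lambda>u v. pure_tensor K U (tensor K V W) u (pure_tensor K V W v w)"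
abbreviation "assoc_outer \<equiv> \<lambda>X w. tensor_lift (tensor K U (tensor K V W)) (assoc_inner w) X"

lemma assoc_inner_bilinear:
  assumes "w \<in> carrier W"
  shows "assoc_inner w \<in> bilinear_maps K U V (tensor K U (tensor K V W))"
  using bilinear_maps_compose[OF linear_maps_id bilinear_maps_right[OF VW.pure_tensor_bilinear assms]
      U_VW.pure_tensor_bilinear] by simp

lemma assoc_outer_linear:
  assumes "w \<in> carrier W"
  shows "(\<lambda>X. assoc_outer X w) \<in> linear_maps K (tensor K U V) (tensor K U (tensor K V W))"
  by (rule UV.tensor_lift_linear[OF U_VW.module_tensor assoc_inner_bilinear[OF assms]])

lemma assoc_outer_pure:
  "u \<in> carrier U \<Longrightarrow> v \<in> carrier V \<Longrightarrow> w \<in> carrier W \<Longrightarrow>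
   assoc_outer (pure_tensor K U V u v) w = assoc_inner w u v"
  by (rule UV.tensor_lift_pure[OF U_VW.module_tensor assoc_inner_bilinear])

text \<open>Linearity in the tensor \<open>X\<close> comes with the lift. Linearity in
  \<open>w\<close> does not: for it, both sides of each law are regarded as linear in
  \<open>X\<close> and compared on pure tensors.\<close>

lemma assoc_outer_bilinear:
  "assoc_outer \<in> bilinear_maps K (tensor K U V) W (tensor K U (tensor K V W))"
  unfolding bilinear_maps_def
proof (intro CollectI conjI ballI)
  fix w assume "w \<in> carrier W"
  then show "(\<lambda>X. assoc_outer X w) \<in> linear_maps K (tensor K U V) (tensor K U (tensor K V W))"
    by (rule assoc_outer_linear)
next
  note P = U_VW.module_tensor
  fix X assume X: "X \<in> carrier (tensor K U V)"
  show "assoc_outer X \<in> linear_maps K W (tensor K U (tensor K V W))"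
  proof (rule linear_mapsI)
    fix w assume "w \<in> carrier W"
    then show "assoc_outer X w \<in> carrier (tensor K U (tensor K V W))"
      by (rule linear_maps_closed[OF assoc_outer_linear X])
  next
    fix w w' assume w: "w \<in> carrier W" "w' \<in> carrier W"
    show "assoc_outer X (w \<oplus>\<^bsub>W\<^esub> w') =
      assoc_outer X w \<oplus>\<^bsub>tensor K U (tensor K V W)\<^esub> assoc_outer X w'"
      by (rule UV.tensor_linear_eqI[OF P assoc_outer_linear
            linear_maps_sum[OF P assoc_outer_linear[OF w(1)] assoc_outer_linear[OF w(2)]] _ X])
        (use w in \<open>simp_all add: assoc_outer_pure VW.pure_tensor_add_right VW.pure_tensor_closed
           U_VW.pure_tensor_add_right\<close>)
  next
    fix c w assume w: "c \<in> carrier K" "w \<in> carrier W"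
    have bal: "pure_tensor K V W v (c \<odot>\<^bsub>W\<^esub> w) = c \<odot>\<^bsub>tensor K V W\<^esub> pure_tensor K V W v w"
      if "v \<in> carrier V" for v
      using linear_maps_smult[OF bilinear_maps_left[OF VW.pure_tensor_bilinear that] w] .
    have bal': "pure_tensor K U (tensor K V W) u (c \<odot>\<^bsub>tensor K V W\<^esub> Y) =
        c \<odot>\<^bsub>tensor K U (tensor K V W)\<^esub> pure_tensor K U (tensor K V W) u Y"
      if "u \<in> carrier U" "Y \<in> carrier (tensor K V W)" for u Y
      using linear_maps_smult[OF bilinear_maps_left[OF U_VW.pure_tensor_bilinear that(1)] w(1) that(2)] .
    show "assoc_outer X (c \<odot>\<^bsub>W\<^esub> w) = c \<odot>\<^bsub>tensor K U (tensor K V W)\<^esub> assoc_outer X w"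
      by (rule UV.tensor_linear_eqI[OF P assoc_outer_linear
            linear_maps_scale[OF P w(1) assoc_outer_linear[OF w(2)]] _ X])
        (use w in \<open>simp_all add: assoc_outer_pure bal bal' VW.pure_tensor_closed\<close>)
  qed
qed

lemma tensor_assoc_linear:
  "tensor_assoc K U V W \<in> linear_maps K (tensor K (tensor K U V) W) (tensor K U (tensor K V W))"
  unfolding tensor_assoc_def Let_def
  by (rule UV_W.tensor_lift_linear[OF U_VW.module_tensor assoc_outer_bilinear])

lemma tensor_assoc_pure:
  assumes "u \<in> carrier U" "v \<in> carrier V" "w \<in> carrier W"
  shows "tensor_assoc K U V W (pure_tensor K (tensor K U V) W (pure_tensor K U V u v) w) =
    pure_tensor K U (tensor K V W) u (pure_tensor K V W v w)"
  unfolding tensor_assoc_def Let_def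
  using UV_W.tensor_lift_pure[OF U_VW.module_tensor assoc_outer_bilinear
      UV.pure_tensor_closed[OF assms(1,2)] assms(3)] assoc_outer_pure[OF assms] by simp

end

text \<open>A single reduction to pure tensors leaves an arbitrary element \<open>Y\<close> of the
  product of \<open>U\<close> and \<open>V\<close> in the left slot. With \<open>w\<close> fixed
  both sides are linear in \<open>Y\<close>, and a second reduction reaches pure tensors of three
  elements.\<close>

lemma tensor_assoc_natural:
  assumes M: "module K U" "module K V" "module K W" and M': "module K U'" "module K V'" "module K W'"
    and f: "f \<in> linear_maps K U U'" and g: "g \<in> linear_maps K V V'" and h: "h \<in> linear_maps K W W'"
    and X: "X \<in> carrier (tensor K (tensor K U V) W)"
  shows "tensor_assoc K U' V' W' (tensor_map K (tensor K U' V') W' (tensor_map K U' V' f g) h X) =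
    tensor_map K U' (tensor K V' W') f (tensor_map K V' W' g h) (tensor_assoc K U V W X)"
proof -
  interpret S: tensor_triple K U V W
    using M by (simp add: tensor_triple_def)
  interpret S': tensor_triple K U' V' W'
    using M' by (simp add: tensor_triple_def)
  note fg = tensor_map_linear[OF M(1,2) M'(1,2) f g]
  note gh = tensor_map_linear[OF M(2,3) M'(2,3) g h]
  note fg_h = tensor_map_linear[OF S.UV.module_tensor M(3) S'.UV.module_tensor M'(3) fg h]
  note f_gh = tensor_map_linear[OF M(1) S.VW.module_tensor M'(1) S'.VW.module_tensor f gh]
  note lhs = linear_maps_compose[OF fg_h S'.tensor_assoc_linear]
  note rhs = linear_maps_compose[OF S.tensor_assoc_linear f_gh]
  note P = S'.U_VW.module_tensor
  show ?thesis
  proof (rule S.UV_W.tensor_linear_eqI[OF P lhs rhs _ X])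
    fix Y w assume Y: "Y \<in> carrier (tensor K U V)" and w: "w \<in> carrier W"
    note pw = bilinear_maps_right[OF S.UV_W.pure_tensor_bilinear w]
    show "tensor_assoc K U' V' W' (tensor_map K (tensor K U' V') W' (tensor_map K U' V' f g) h
        (pure_tensor K (tensor K U V) W Y w)) =
      tensor_map K U' (tensor K V' W') f (tensor_map K V' W' g h)
        (tensor_assoc K U V W (pure_tensor K (tensor K U V) W Y w))"
    proof (rule S.UV.tensor_linear_eqI[OF P linear_maps_compose[OF pw lhs] linear_maps_compose[OF pw rhs] _ Y])
      fix u v assume uv: "u \<in> carrier U" "v \<in> carrier V"
      note cl = linear_maps_closed[OF f uv(1)] linear_maps_closed[OF g uv(2)] linear_maps_closed[OF h w]
      show "tensor_assoc K U' V' W' (tensor_map K (tensor K U' V') W' (tensor_map K U' V' f g) h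
          (pure_tensor K (tensor K U V) W (pure_tensor K U V u v) w)) =
        tensor_map K U' (tensor K V' W') f (tensor_map K V' W' g h)
          (tensor_assoc K U V W (pure_tensor K (tensor K U V) W (pure_tensor K U V u v) w))"
        using uv w cl
        by (simp add: S.tensor_assoc_pure S'.tensor_assoc_pure S.UV.pure_tensor_closed S.VW.pure_tensor_closed
            tensor_map_pure[OF S.UV.module_tensor M(3) S'.UV.module_tensor M'(3) fg h]
            tensor_map_pure[OF M(1) S.VW.module_tensor M'(1) S'.VW.module_tensor f gh]
            tensor_map_pure[OF M(1,2) M'(1,2) f g] tensor_map_pure[OF M(2,3) M'(2,3) g h])
    qed
  qed
qed

section \<open>Twisting\<close>

text \<open>
  For \<open>(X\<^sub>1, X\<^sub>2, X\<^sub>3)\<close> = (A, A, A), (A, A, M), (M, A, A), (A, M, A) this is the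
  coassociativity of \<open>\<Delta>\<close>, \<open>\<rho>\<close>, \<open>\<phi>\<close> and the compatibility of \<open>\<rho>\<close> with \<open>\<phi>\<close>, respectively.
\<close>

lemma coassociativity_twist:
  assumes M: "module K X\<^sub>1" "module K X\<^sub>2" "module K X\<^sub>3" and P: "module K P" and Q: "module K Q"
    and p: "p \<in> linear_maps K P (tensor K X\<^sub>1 X\<^sub>2)" and q: "q \<in> linear_maps K Q (tensor K X\<^sub>2 X\<^sub>3)"
    and L: "L \<in> carrier (tensor K P X\<^sub>3)" and R: "R \<in> carrier (tensor K X\<^sub>1 Q)"
    and coassoc: "tensor_assoc K X\<^sub>1 X\<^sub>2 X\<^sub>3 (tensor_map K (tensor K X\<^sub>1 X\<^sub>2) X\<^sub>3 p id L) =
      tensor_map K X\<^sub>1 (tensor K X\<^sub>2 X\<^sub>3) id q R"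
    and \<omega>\<^sub>1: "\<omega>\<^sub>1 \<in> linear_maps K X\<^sub>1 X\<^sub>1"
    and \<omega>\<^sub>2: "\<omega>\<^sub>2 \<in> linear_maps K X\<^sub>2 X\<^sub>2" and \<psi>\<^sub>2: "\<psi>\<^sub>2 \<in> linear_maps K X\<^sub>2 X\<^sub>2"
    and \<psi>\<^sub>3: "\<psi>\<^sub>3 \<in> linear_maps K X\<^sub>3 X\<^sub>3"
    and \<omega>\<^sub>P: "\<omega>\<^sub>P \<in> linear_maps K P P" and \<psi>\<^sub>Q: "\<psi>\<^sub>Q \<in> linear_maps K Q Q"
    and p_omega: "\<And>x. x \<in> carrier P \<Longrightarrow> p (\<omega>\<^sub>P x) = tensor_map K X\<^sub>1 X\<^sub>2 \<omega>\<^sub>1 \<omega>\<^sub>2 (p x)"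
    and q_psi: "\<And>y. y \<in> carrier Q \<Longrightarrow> q (\<psi>\<^sub>Q y) = tensor_map K X\<^sub>2 X\<^sub>3 \<psi>\<^sub>2 \<psi>\<^sub>3 (q y)"
    and comm: "\<And>z. z \<in> carrier X\<^sub>2 \<Longrightarrow> \<psi>\<^sub>2 (\<omega>\<^sub>2 z) = \<omega>\<^sub>2 (\<psi>\<^sub>2 z)"
  shows "tensor_assoc K X\<^sub>1 X\<^sub>2 X\<^sub>3 (tensor_map K (tensor K X\<^sub>1 X\<^sub>2) X\<^sub>3
      (\<lambda>x. tensor_map K X\<^sub>1 X\<^sub>2 \<omega>\<^sub>1 \<psi>\<^sub>2 (p x)) \<psi>\<^sub>3 (tensor_map K P X\<^sub>3 \<omega>\<^sub>P \<psi>\<^sub>3 L)) =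
    tensor_map K X\<^sub>1 (tensor K X\<^sub>2 X\<^sub>3) \<omega>\<^sub>1 (\<lambda>y. tensor_map K X\<^sub>2 X\<^sub>3 \<omega>\<^sub>2 \<psi>\<^sub>3 (q y))
      (tensor_map K X\<^sub>1 Q \<omega>\<^sub>1 \<psi>\<^sub>Q R)" (is "tensor_assoc K X\<^sub>1 X\<^sub>2 X\<^sub>3 ?l = ?r")
proof -
  note M12 = module_tensor[OF M(1,2)] and M23 = module_tensor[OF M(2,3)]
  note \<omega>\<omega> = linear_maps_compose[OF \<omega>\<^sub>1 \<omega>\<^sub>1] and \<omega>\<psi> = linear_maps_compose[OF \<psi>\<^sub>2 \<omega>\<^sub>2]
    and \<psi>\<psi> = linear_maps_compose[OF \<psi>\<^sub>3 \<psi>\<^sub>3]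
  note tp = linear_maps_compose[OF p tensor_map_linear[OF M(1,2,1,2) \<omega>\<^sub>1 \<psi>\<^sub>2]]
  note tq = linear_maps_compose[OF q tensor_map_linear[OF M(2,3,2,3) \<omega>\<^sub>2 \<psi>\<^sub>3]]
  note t12 = tensor_map_linear[OF M(1,2,1,2) \<omega>\<omega> \<omega>\<psi>]
  note t23 = tensor_map_linear[OF M(2,3,2,3) \<omega>\<psi> \<psi>\<psi>]
  \<comment> \<open>The two bracketings of one triple of outer maps:
    \<open>\<omega>\<^sub>1\<omega>\<^sub>1\<close> on the left slot,
    \<open>\<omega>\<^sub>2\<psi>\<^sub>2\<close> on the middle,
    \<open>\<psi>\<^sub>3\<psi>\<^sub>3\<close> on the right.\<close>
  let ?t12 = "tensor_map K X\<^sub>1 X\<^sub>2 (\<lambda>x. \<omega>\<^sub>1 (\<omega>\<^sub>1 x)) (\<lambda>x. \<omega>\<^sub>2 (\<psi>\<^sub>2 x))"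
  let ?t23 = "tensor_map K X\<^sub>2 X\<^sub>3 (\<lambda>x. \<omega>\<^sub>2 (\<psi>\<^sub>2 x)) (\<lambda>x. \<psi>\<^sub>3 (\<psi>\<^sub>3 x))"
  have l: "?l = tensor_map K (tensor K X\<^sub>1 X\<^sub>2) X\<^sub>3 ?t12 (\<lambda>x. \<psi>\<^sub>3 (\<psi>\<^sub>3 x))
    (tensor_map K (tensor K X\<^sub>1 X\<^sub>2) X\<^sub>3 p id L)"
  proof (rule tensor_map_compose_eq[OF P M(3) P M(3) M12 M(3) M12 M(3) \<omega>\<^sub>P \<psi>\<^sub>3 tp \<psi>\<^sub>3 p linear_maps_id t12 \<psi>\<psi> _ _ L])
    fix x assume x: "x \<in> carrier P"
    have px: "p x \<in> carrier (tensor K X\<^sub>1 X\<^sub>2)" by (rule linear_maps_closed[OF p x])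
    have "tensor_map K X\<^sub>1 X\<^sub>2 \<omega>\<^sub>1 \<psi>\<^sub>2 (tensor_map K X\<^sub>1 X\<^sub>2 \<omega>\<^sub>1 \<omega>\<^sub>2 (p x)) = ?t12 (p x)"
      \<comment> \<open>Moving \<open>\<omega>\<^sub>P\<close> through \<open>p\<close> leaves
        \<open>\<psi>\<^sub>2\<omega>\<^sub>2\<close> on the middle slot, so \<open>comm\<close> is
        required here. On the other side \<open>\<psi>\<^sub>Q\<close> moves through
        \<open>q\<close> and the order \<open>\<omega>\<^sub>2\<psi>\<^sub>2\<close> appears
        directly.\<close>
      unfolding tensor_map_compose[OF M(1,2,1,2,1,2) \<omega>\<^sub>1 \<omega>\<^sub>2 \<omega>\<^sub>1 \<psi>\<^sub>2 px]
      by (rule tensor_map_cong[OF M(1,2,1,2) \<omega>\<omega> linear_maps_compose[OF \<omega>\<^sub>2 \<psi>\<^sub>2] \<omega>\<omega> \<omega>\<psi> refl comm px])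
    then show "tensor_map K X\<^sub>1 X\<^sub>2 \<omega>\<^sub>1 \<psi>\<^sub>2 (p (\<omega>\<^sub>P x)) = ?t12 (p x)"
      by (simp add: p_omega[OF x])
  qed simp
  have r: "?r = tensor_map K X\<^sub>1 (tensor K X\<^sub>2 X\<^sub>3) (\<lambda>x. \<omega>\<^sub>1 (\<omega>\<^sub>1 x)) ?t23
    (tensor_map K X\<^sub>1 (tensor K X\<^sub>2 X\<^sub>3) id q R)"
  proof (rule tensor_map_compose_eq[OF M(1) Q M(1) Q M(1) M23 M(1) M23 \<omega>\<^sub>1 \<psi>\<^sub>Q \<omega>\<^sub>1 tq linear_maps_id q \<omega>\<omega> t23 _ _ R])
    fix y assume y: "y \<in> carrier Q"
    show "tensor_map K X\<^sub>2 X\<^sub>3 \<omega>\<^sub>2 \<psi>\<^sub>3 (q (\<psi>\<^sub>Q y)) = ?t23 (q y)"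
      unfolding q_psi[OF y]
      by (rule tensor_map_compose[OF M(2,3,2,3,2,3) \<psi>\<^sub>2 \<psi>\<^sub>3 \<omega>\<^sub>2 \<psi>\<^sub>3 linear_maps_closed[OF q y]])
  qed simp
  show ?thesis
    \<comment> \<open>Both sides now apply the same three outer maps to the two sides of the
      untwisted axiom, before and after reassociation; naturality identifies them.\<close>
    unfolding l r coassoc[symmetric]
    by (rule tensor_assoc_natural[OF M M \<omega>\<omega> \<omega>\<psi> \<psi>\<psi>
          linear_maps_closed[OF tensor_map_linear[OF P M(3) M12 M(3) p linear_maps_id] L]])
qed

text \<open>
  For (X, Y) = (A, A), (A, M), (M, A) this is the compatibility condition for \<open>\<Delta>(ab)\<close>,
  \<open>\<rho>(a \<triangleright> m)\<close> and \<open>\<phi>(m \<triangleleft> a)\<close>, respectively.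
\<close>

lemma derivation_twist:
  assumes A: "module K A" and X: "module K X" and Y: "module K Y" and lam: "lam \<in> carrier K"
    and lmul: "lmul \<in> bilinear_maps K X A X" and rmul: "rmul \<in> bilinear_maps K A Y Y"
    and dX: "dX \<in> linear_maps K X (tensor K X A)" and dY: "dY \<in> linear_maps K Y (tensor K A Y)"
    and deriv: "\<And>x y. x \<in> carrier X \<Longrightarrow> y \<in> carrier Y \<Longrightarrow> d (prd x y) =
      tensor_map K X Y (\<lambda>z. lmul x z) id (dY y)
      \<oplus>\<^bsub>tensor K X Y\<^esub> tensor_map K X Y id (\<lambda>z. rmul z y) (dX x)
      \<oplus>\<^bsub>tensor K X Y\<^esub> lam \<odot>\<^bsub>tensor K X Y\<^esub> pure_tensor K X Y x y"
    and linA: "\<alpha>\<^sub>A \<in> linear_maps K A A" "\<beta>\<^sub>A \<in> linear_maps K A A" "\<psi>\<^sub>A \<in> linear_maps K A A" "\<omega>\<^sub>A \<in> linear_maps K A A"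
    and linX: "\<alpha>\<^sub>X \<in> linear_maps K X X" "\<omega>\<^sub>X \<in> linear_maps K X X"
    and linY: "\<beta>\<^sub>Y \<in> linear_maps K Y Y" "\<psi>\<^sub>Y \<in> linear_maps K Y Y"
    and commA: "\<And>a. a \<in> carrier A \<Longrightarrow> \<beta>\<^sub>A (\<omega>\<^sub>A a) = \<omega>\<^sub>A (\<beta>\<^sub>A a)"
      "\<And>a. a \<in> carrier A \<Longrightarrow> \<alpha>\<^sub>A (\<psi>\<^sub>A a) = \<psi>\<^sub>A (\<alpha>\<^sub>A a)"
    and commX: "\<And>x. x \<in> carrier X \<Longrightarrow> \<alpha>\<^sub>X (\<omega>\<^sub>X x) = \<omega>\<^sub>X (\<alpha>\<^sub>X x)"
    and commY: "\<And>y. y \<in> carrier Y \<Longrightarrow> \<beta>\<^sub>Y (\<psi>\<^sub>Y y) = \<psi>\<^sub>Y (\<beta>\<^sub>Y y)"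
    and omega: "\<And>x a. x \<in> carrier X \<Longrightarrow> a \<in> carrier A \<Longrightarrow> \<omega>\<^sub>X (lmul x a) = lmul (\<omega>\<^sub>X x) (\<omega>\<^sub>A a)"
    and psi: "\<And>a y. a \<in> carrier A \<Longrightarrow> y \<in> carrier Y \<Longrightarrow> \<psi>\<^sub>Y (rmul a y) = rmul (\<psi>\<^sub>A a) (\<psi>\<^sub>Y y)"
    and beta: "\<And>y. y \<in> carrier Y \<Longrightarrow> tensor_map K A Y \<beta>\<^sub>A \<beta>\<^sub>Y (dY y) = dY (\<beta>\<^sub>Y y)"
    and alpha: "\<And>x. x \<in> carrier X \<Longrightarrow> tensor_map K X A \<alpha>\<^sub>X \<alpha>\<^sub>A (dX x) = dX (\<alpha>\<^sub>X x)"
    and x: "x \<in> carrier X" and y: "y \<in> carrier Y"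
  shows "tensor_map K X Y \<omega>\<^sub>X \<psi>\<^sub>Y (d (prd (\<alpha>\<^sub>X x) (\<beta>\<^sub>Y y))) =
    tensor_map K X Y (\<lambda>z. lmul (\<alpha>\<^sub>X (\<omega>\<^sub>X x)) (\<beta>\<^sub>A z)) \<beta>\<^sub>Y (tensor_map K A Y \<omega>\<^sub>A \<psi>\<^sub>Y (dY y))
    \<oplus>\<^bsub>tensor K X Y\<^esub> tensor_map K X Y \<alpha>\<^sub>X (\<lambda>z. rmul (\<alpha>\<^sub>A z) (\<beta>\<^sub>Y (\<psi>\<^sub>Y y))) (tensor_map K X A \<omega>\<^sub>X \<psi>\<^sub>A (dX x))
    \<oplus>\<^bsub>tensor K X Y\<^esub> lam \<odot>\<^bsub>tensor K X Y\<^esub> pure_tensor K X Y (\<alpha>\<^sub>X (\<omega>\<^sub>X x)) (\<beta>\<^sub>Y (\<psi>\<^sub>Y y))"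
proof -
  interpret XY: tensor_product K X Y using X Y by (simp add: tensor_product_def)
  note clX = linear_maps_closed[OF linX(1)] linear_maps_closed[OF linX(2)]
  note clY = linear_maps_closed[OF linY(1)] linear_maps_closed[OF linY(2)]
  note clA = linear_maps_closed[OF linA(1)] linear_maps_closed[OF linA(2)] linear_maps_closed[OF linA(3)]
    linear_maps_closed[OF linA(4)]
  have ax: "\<alpha>\<^sub>X x \<in> carrier X" and by': "\<beta>\<^sub>Y y \<in> carrier Y"
    and awx: "\<alpha>\<^sub>X (\<omega>\<^sub>X x) \<in> carrier X" and bpy: "\<beta>\<^sub>Y (\<psi>\<^sub>Y y) \<in> carrier Y"
    using x y by (simp_all add: clX clY)
  note dXx = linear_maps_closed[OF dX x] and dYy = linear_maps_closed[OF dY y]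
  note lx = bilinear_maps_left[OF lmul ax] and ry = bilinear_maps_right[OF rmul by']
  note lx' = linear_maps_compose[OF linA(2) bilinear_maps_left[OF lmul awx]]
  note ry' = linear_maps_compose[OF linA(1) bilinear_maps_right[OF rmul bpy]]
  note W = tensor_map_linear[OF X Y X Y linX(2) linY(2)]
  \<comment> \<open>The three summands of the untwisted rule at the arguments
    \<open>\<alpha>\<^sub>X x\<close> and \<open>\<beta>\<^sub>Y y\<close>, which the twisted
    product supplies.\<close>
  let ?a = "tensor_map K X Y (\<lambda>z. lmul (\<alpha>\<^sub>X x) z) id (dY (\<beta>\<^sub>Y y))"
  let ?b = "tensor_map K X Y id (\<lambda>z. rmul z (\<beta>\<^sub>Y y)) (dX (\<alpha>\<^sub>X x))"
  let ?c = "pure_tensor K X Y (\<alpha>\<^sub>X x) (\<beta>\<^sub>Y y)"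
  have cl: "?a \<in> carrier (tensor K X Y)" "?b \<in> carrier (tensor K X Y)" "?c \<in> carrier (tensor K X Y)"
    using linear_maps_closed[OF tensor_map_linear[OF A Y X Y lx linear_maps_id] linear_maps_closed[OF dY by']]
      linear_maps_closed[OF tensor_map_linear[OF X A X Y linear_maps_id ry] linear_maps_closed[OF dX ax]]
      XY.pure_tensor_closed[OF ax by'] by simp_all
  \<comment> \<open>By comultiplicativity \<open>\<beta>\<close> leaves the argument of
    \<open>dY\<close> and acts on both tensor factors; multiplicativity of \<open>\<omega>\<close>
    then distributes it over \<open>lmul\<close>. The map \<open>\<lambda>z. lmul (\<alpha>\<^sub>X
    (\<omega>\<^sub>X x)) (\<beta>\<^sub>A z)\<close> is multiplication of \<open>z\<close> by
    \<open>\<omega>\<^sub>X x\<close> in the twisted product.\<close>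
  have a: "tensor_map K X Y \<omega>\<^sub>X \<psi>\<^sub>Y ?a =
    tensor_map K X Y (\<lambda>z. lmul (\<alpha>\<^sub>X (\<omega>\<^sub>X x)) (\<beta>\<^sub>A z)) \<beta>\<^sub>Y (tensor_map K A Y \<omega>\<^sub>A \<psi>\<^sub>Y (dY y))"
    unfolding beta[OF y, symmetric]
      tensor_map_compose[OF A Y A Y X Y linA(2) linY(1) lx linear_maps_id dYy]
    by (rule tensor_map_compose_eq[OF A Y X Y A Y X Y linear_maps_compose[OF linA(2) lx]
          linear_maps_compose[OF linY(1) linear_maps_id] linX(2) linY(2) linA(4) linY(2) lx' linY(1) _ _ dYy])
      (simp_all add: omega ax clA commA commX[OF x] commY)
  \<comment> \<open>The mirror image: \<open>\<alpha>\<close> passes through \<open>dX\<close> and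
    \<open>\<psi>\<close> distributes over \<open>rmul\<close>.\<close>
  have b: "tensor_map K X Y \<omega>\<^sub>X \<psi>\<^sub>Y ?b =
    tensor_map K X Y \<alpha>\<^sub>X (\<lambda>z. rmul (\<alpha>\<^sub>A z) (\<beta>\<^sub>Y (\<psi>\<^sub>Y y))) (tensor_map K X A \<omega>\<^sub>X \<psi>\<^sub>A (dX x))"
    unfolding alpha[OF x, symmetric]
      tensor_map_compose[OF X A X A X Y linX(1) linA(1) linear_maps_id ry dXx]
    by (rule tensor_map_compose_eq[OF X A X Y X A X Y linear_maps_compose[OF linX(1) linear_maps_id]
          linear_maps_compose[OF linA(1) ry] linX(2) linY(2) linX(2) linA(3) linX(1) ry' _ _ dXx])
      (simp_all add: psi by' clA commA commX commY[OF y])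
  have c: "tensor_map K X Y \<omega>\<^sub>X \<psi>\<^sub>Y ?c = pure_tensor K X Y (\<alpha>\<^sub>X (\<omega>\<^sub>X x)) (\<beta>\<^sub>Y (\<psi>\<^sub>Y y))"
    using tensor_map_pure[OF X Y X Y linX(2) linY(2) ax by'] commX[OF x] commY[OF y] by simp
  show ?thesis
    unfolding deriv[OF ax by'] using lam cl
    by (simp add: linear_maps_add[OF W] linear_maps_smult[OF W] a b c)
qed

text \<open>With \<omega> \<otimes> \<psi> as one of the two maps, this carries compatibility of a
  structure map with a coproduct or coaction over to the twisted one.\<close>

lemma tensor_map_commute:
  assumes "module K V" "module K W"
    and "f \<in> linear_maps K V V" "g \<in> linear_maps K W W" "p \<in> linear_maps K V V" "q \<in> linear_maps K W W"
    and "\<And>v. v \<in> carrier V \<Longrightarrow> f (p v) = p (f v)" "\<And>w. w \<in> carrier W \<Longrightarrow> g (q w) = q (g w)"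
    and "X \<in> carrier (tensor K V W)"
  shows "tensor_map K V W f g (tensor_map K V W p q X) = tensor_map K V W p q (tensor_map K V W f g X)"
  by (rule tensor_map_compose_eq[where V = V and W = W]) (use assms in auto)

section \<open>The twisted bialgebra\<close>

lemma infBH_bialgebra_twist:
  assumes "inf_bialgebra K lam A mult_A \<Delta>"
    and endo: "\<forall>f\<in>{\<alpha>\<^sub>A, \<beta>\<^sub>A, \<psi>\<^sub>A, \<omega>\<^sub>A}. bialgebra_endomorphism K A mult_A \<Delta> f"
    and comm: "\<forall>f\<in>{\<alpha>\<^sub>A, \<beta>\<^sub>A, \<psi>\<^sub>A, \<omega>\<^sub>A}. \<forall>g\<in>{\<alpha>\<^sub>A, \<beta>\<^sub>A, \<psi>\<^sub>A, \<omega>\<^sub>A}. \<forall>a\<in>carrier A. f (g a) = g (f a)"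
  shows "infBH_bialgebra K lam A (\<lambda>a b. mult_A (\<alpha>\<^sub>A a) (\<beta>\<^sub>A b)) (\<lambda>a. tensor_map K A A \<omega>\<^sub>A \<psi>\<^sub>A (\<Delta> a))
    \<alpha>\<^sub>A \<beta>\<^sub>A \<psi>\<^sub>A \<omega>\<^sub>A"
proof -
  interpret B: infBH_bialgebra K lam A mult_A \<Delta> id id id id
    using assms(1) by (simp add: inf_bialgebra_def)
  have A: "module K A" by (rule B.module_axioms)
  have lin: "\<alpha>\<^sub>A \<in> linear_maps K A A" "\<beta>\<^sub>A \<in> linear_maps K A A" "\<psi>\<^sub>A \<in> linear_maps K A A" "\<omega>\<^sub>A \<in> linear_maps K A A"
    using endo by (auto simp: bialgebra_endomorphism_def)
  note cl [simp] = linear_maps_closed[OF lin(1)] linear_maps_closed[OF lin(2)] linear_maps_closed[OF lin(3)]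
    linear_maps_closed[OF lin(4)] bilinear_maps_closed[OF B.mult_bilinear] linear_maps_closed[OF B.Delta_linear]
  have mul: "f (mult_A a b) = mult_A (f a) (f b)"
    if "f \<in> {\<alpha>\<^sub>A, \<beta>\<^sub>A, \<psi>\<^sub>A, \<omega>\<^sub>A}" "a \<in> carrier A" "b \<in> carrier A" for f a b
    using endo that unfolding bialgebra_endomorphism_def by blast
  have Delta: "tensor_map K A A f f (\<Delta> a) = \<Delta> (f a)"
    if "f \<in> {\<alpha>\<^sub>A, \<beta>\<^sub>A, \<psi>\<^sub>A, \<omega>\<^sub>A}" "a \<in> carrier A" for f a
    using endo that unfolding bialgebra_endomorphism_def by blast
  have c: "\<alpha>\<^sub>A (\<beta>\<^sub>A a) = \<beta>\<^sub>A (\<alpha>\<^sub>A a)" "\<alpha>\<^sub>A (\<psi>\<^sub>A a) = \<psi>\<^sub>A (\<alpha>\<^sub>A a)" "\<alpha>\<^sub>A (\<omega>\<^sub>A a) = \<omega>\<^sub>A (\<alpha>\<^sub>A a)"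
    "\<beta>\<^sub>A (\<psi>\<^sub>A a) = \<psi>\<^sub>A (\<beta>\<^sub>A a)" "\<beta>\<^sub>A (\<omega>\<^sub>A a) = \<omega>\<^sub>A (\<beta>\<^sub>A a)" "\<psi>\<^sub>A (\<omega>\<^sub>A a) = \<omega>\<^sub>A (\<psi>\<^sub>A a)"
    if "a \<in> carrier A" for a
    using comm that by blast+
  have twist_Delta: "tensor_map K A A f f (tensor_map K A A \<omega>\<^sub>A \<psi>\<^sub>A (\<Delta> a)) =
      tensor_map K A A \<omega>\<^sub>A \<psi>\<^sub>A (\<Delta> (f a))"
    if "f \<in> {\<alpha>\<^sub>A, \<beta>\<^sub>A, \<psi>\<^sub>A, \<omega>\<^sub>A}" "a \<in> carrier A" for f a
    unfolding Delta[OF that, symmetric]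
    by (rule tensor_map_commute[OF A A _ _ lin(4,3)]) (use that lin comm in auto)
  have assoc: "mult_A a (mult_A b c) = mult_A (mult_A a b) c"
    if "a \<in> carrier A" "b \<in> carrier A" "c \<in> carrier A" for a b c
    using B.bihom_assoc that by simp
  have "bihom_assoc_algebra K A (\<lambda>a b. mult_A (\<alpha>\<^sub>A a) (\<beta>\<^sub>A b)) \<alpha>\<^sub>A \<beta>\<^sub>A"
  proof (intro bihom_assoc_algebra.intro bihom_assoc_algebra_axioms.intro)
    show "(\<lambda>a b. mult_A (\<alpha>\<^sub>A a) (\<beta>\<^sub>A b)) \<in> bilinear_maps K A A A"
      by (rule bilinear_maps_compose[OF lin(1,2) B.mult_bilinear])
  \<comment> \<open>By multiplicativity both sides of BiHom-associativity are products of
    \<alpha>\<alpha>a, \<alpha>\<beta>b and \<beta>\<beta>c in the two bracketings, so ordinary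
    associativity remains.\<close>
  qed (use lin A B.field_axioms in \<open>simp_all add: mul c assoc\<close>)
  moreover have "bihom_coassoc_coalgebra K A (\<lambda>a. tensor_map K A A \<omega>\<^sub>A \<psi>\<^sub>A (\<Delta> a)) \<psi>\<^sub>A \<omega>\<^sub>A"
  proof (intro bihom_coassoc_coalgebra.intro bihom_coassoc_coalgebra_axioms.intro)
    show "(\<lambda>a. tensor_map K A A \<omega>\<^sub>A \<psi>\<^sub>A (\<Delta> a)) \<in> linear_maps K A (tensor K A A)"
      by (rule linear_maps_compose[OF B.Delta_linear tensor_map_linear[OF A A A A lin(4,3)]])
    show "\<forall>a\<in>carrier A. tensor_assoc K A A A (tensor_map K (tensor K A A) A
        (\<lambda>a. tensor_map K A A \<omega>\<^sub>A \<psi>\<^sub>A (\<Delta> a)) \<psi>\<^sub>A (tensor_map K A A \<omega>\<^sub>A \<psi>\<^sub>A (\<Delta> a))) =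
      tensor_map K A (tensor K A A) \<omega>\<^sub>A (\<lambda>a. tensor_map K A A \<omega>\<^sub>A \<psi>\<^sub>A (\<Delta> a))
        (tensor_map K A A \<omega>\<^sub>A \<psi>\<^sub>A (\<Delta> a))"
      \<comment> \<open>Here \<open>P\<close> and \<open>Q\<close> are both \<open>A\<close>,
        \<open>p\<close> and \<open>q\<close> are both \<open>\<Delta>\<close>, and \<open>L\<close>
        and \<open>R\<close> are both \<open>\<Delta> a\<close>.\<close>
      using B.bihom_coassoc
      by (intro ballI coassociativity_twist[OF A A A A A B.Delta_linear B.Delta_linear _ _ _
            lin(4,4,3,3,4,3)])
        (simp_all add: Delta c)
  qed (use lin A B.field_axioms in \<open>simp_all add: c twist_Delta\<close>)
  moreover have "tensor_map K A A \<omega>\<^sub>A \<psi>\<^sub>A (\<Delta> (mult_A (\<alpha>\<^sub>A a) (\<beta>\<^sub>A b))) =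
      tensor_map K A A (\<lambda>x. mult_A (\<alpha>\<^sub>A (\<omega>\<^sub>A a)) (\<beta>\<^sub>A x)) \<beta>\<^sub>A (tensor_map K A A \<omega>\<^sub>A \<psi>\<^sub>A (\<Delta> b))
      \<oplus>\<^bsub>tensor K A A\<^esub> tensor_map K A A \<alpha>\<^sub>A (\<lambda>x. mult_A (\<alpha>\<^sub>A x) (\<beta>\<^sub>A (\<psi>\<^sub>A b))) (tensor_map K A A \<omega>\<^sub>A \<psi>\<^sub>A (\<Delta> a))
      \<oplus>\<^bsub>tensor K A A\<^esub> lam \<odot>\<^bsub>tensor K A A\<^esub> pure_tensor K A A (\<alpha>\<^sub>A (\<omega>\<^sub>A a)) (\<beta>\<^sub>A (\<psi>\<^sub>A b))"
    if "a \<in> carrier A" "b \<in> carrier A" for a b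
    using B.Delta_mult that
    by (intro derivation_twist[OF A A A B.lam_closed B.mult_bilinear B.mult_bilinear B.Delta_linear
          B.Delta_linear _ lin lin(1,4,2,3)])
      (simp_all add: mul c Delta)
  ultimately show ?thesis
    by (intro infBH_bialgebra.intro infBH_bialgebra_axioms.intro)
      (simp_all add: B.lam_closed c mul twist_Delta)
qed

section \<open>The twisted Hopf bimodule\<close>

theorem theorem2p10:
  fixes K :: "('k, 'x) ring_scheme" and lam :: 'k
    and A :: "('k, 'a, 'y) module_scheme" and mult_A :: "'a \<Rightarrow> 'a \<Rightarrow> 'a"
    and \<Delta> :: "'a \<Rightarrow> ('a \<times> 'a \<Rightarrow>\<^sub>0 int) set"
    and M :: "('k, 'm, 'z) module_scheme"
    and lact :: "'a \<Rightarrow> 'm \<Rightarrow> 'm" and ract :: "'m \<Rightarrow> 'a \<Rightarrow> 'm"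
    and \<rho> :: "'m \<Rightarrow> ('a \<times> 'm \<Rightarrow>\<^sub>0 int) set" and \<phi> :: "'m \<Rightarrow> ('m \<times> 'a \<Rightarrow>\<^sub>0 int) set"
    and \<alpha>\<^sub>A \<beta>\<^sub>A \<psi>\<^sub>A \<omega>\<^sub>A :: "'a \<Rightarrow> 'a"
    and \<alpha>\<^sub>M \<beta>\<^sub>M \<psi>\<^sub>M \<omega>\<^sub>M :: "'m \<Rightarrow> 'm"
  assumes "field K" and "lam \<in> carrier K"
    and "inf_bialgebra K lam A mult_A \<Delta>"
    and "inf_Hopf_bimodule K lam A mult_A \<Delta> M lact ract \<rho> \<phi>"
    and "\<forall>f\<in>{\<alpha>\<^sub>A, \<beta>\<^sub>A, \<psi>\<^sub>A, \<omega>\<^sub>A}. bialgebra_endomorphism K A mult_A \<Delta> f"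
    and "\<forall>f\<in>{\<alpha>\<^sub>A, \<beta>\<^sub>A, \<psi>\<^sub>A, \<omega>\<^sub>A}. \<forall>g\<in>{\<alpha>\<^sub>A, \<beta>\<^sub>A, \<psi>\<^sub>A, \<omega>\<^sub>A}. \<forall>a\<in>carrier A. f (g a) = g (f a)"
    and "\<forall>f\<in>{\<alpha>\<^sub>M, \<beta>\<^sub>M, \<psi>\<^sub>M, \<omega>\<^sub>M}. f \<in> linear_maps K M M"
    and "\<forall>f\<in>{\<alpha>\<^sub>M, \<beta>\<^sub>M, \<psi>\<^sub>M, \<omega>\<^sub>M}. \<forall>g\<in>{\<alpha>\<^sub>M, \<beta>\<^sub>M, \<psi>\<^sub>M, \<omega>\<^sub>M}. \<forall>m\<in>carrier M. f (g m) = g (f m)"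
    and "\<forall>(f\<^sub>A, f\<^sub>M)\<in>{(\<alpha>\<^sub>A, \<alpha>\<^sub>M), (\<beta>\<^sub>A, \<beta>\<^sub>M), (\<psi>\<^sub>A, \<psi>\<^sub>M), (\<omega>\<^sub>A, \<omega>\<^sub>M)}.
      (\<forall>a\<in>carrier A. \<forall>m\<in>carrier M. f\<^sub>M (lact a m) = lact (f\<^sub>A a) (f\<^sub>M m)) \<and>
      (\<forall>a\<in>carrier A. \<forall>m\<in>carrier M. f\<^sub>M (ract m a) = ract (f\<^sub>M m) (f\<^sub>A a)) \<and>
      (\<forall>m\<in>carrier M. \<rho> (f\<^sub>M m) = tensor_map K A M f\<^sub>A f\<^sub>M (\<rho> m)) \<and>
      (\<forall>m\<in>carrier M. \<phi> (f\<^sub>M m) = tensor_map K M A f\<^sub>M f\<^sub>A (\<phi> m))"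
  shows "infBH_Hopf_bimodule K lam A
    (\<lambda>a b. mult_A (\<alpha>\<^sub>A a) (\<beta>\<^sub>A b)) (\<lambda>a. tensor_map K A A \<omega>\<^sub>A \<psi>\<^sub>A (\<Delta> a)) \<alpha>\<^sub>A \<beta>\<^sub>A \<psi>\<^sub>A \<omega>\<^sub>A
    M (\<lambda>a m. lact (\<alpha>\<^sub>A a) (\<beta>\<^sub>M m)) (\<lambda>m a. ract (\<alpha>\<^sub>M m) (\<beta>\<^sub>A a))
    (\<lambda>m. tensor_map K A M \<omega>\<^sub>A \<psi>\<^sub>M (\<rho> m)) (\<lambda>m. tensor_map K M A \<omega>\<^sub>M \<psi>\<^sub>A (\<phi> m))
    \<alpha>\<^sub>M \<beta>\<^sub>M \<psi>\<^sub>M \<omega>\<^sub>M"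
proof -
  interpret H: infBH_Hopf_bimodule K lam A mult_A \<Delta> id id id id M lact ract \<rho> \<phi> id id id id
    using assms(4) by (simp add: inf_Hopf_bimodule_def)
  have A: "module K A" and M: "module K M"
    by (rule H.module_axioms H.M.module_axioms)+
  have lin: "\<alpha>\<^sub>A \<in> linear_maps K A A" "\<beta>\<^sub>A \<in> linear_maps K A A" "\<psi>\<^sub>A \<in> linear_maps K A A" "\<omega>\<^sub>A \<in> linear_maps K A A"
    using assms(5) by (auto simp: bialgebra_endomorphism_def)
  have linM: "\<alpha>\<^sub>M \<in> linear_maps K M M" "\<beta>\<^sub>M \<in> linear_maps K M M" "\<psi>\<^sub>M \<in> linear_maps K M M" "\<omega>\<^sub>M \<in> linear_maps K M M"
    using assms(7) by auto
  note cl [simp] = linear_maps_closed[OF lin(1)] linear_maps_closed[OF lin(2)] linear_maps_closed[OF lin(3)]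
    linear_maps_closed[OF lin(4)] linear_maps_closed[OF linM(1)] linear_maps_closed[OF linM(2)]
    linear_maps_closed[OF linM(3)] linear_maps_closed[OF linM(4)]
    bilinear_maps_closed[OF H.mult_bilinear] bilinear_maps_closed[OF H.lact_bilinear]
    bilinear_maps_closed[OF H.ract_bilinear] linear_maps_closed[OF H.Delta_linear]
    linear_maps_closed[OF H.rho_linear] linear_maps_closed[OF H.phi_linear]
  have mul: "f (mult_A a b) = mult_A (f a) (f b)"
    if "f \<in> {\<alpha>\<^sub>A, \<beta>\<^sub>A, \<psi>\<^sub>A, \<omega>\<^sub>A}" "a \<in> carrier A" "b \<in> carrier A" for f a b
    using assms(5) that unfolding bialgebra_endomorphism_def by blast
  have Delta: "tensor_map K A A f f (\<Delta> a) = \<Delta> (f a)"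
    if "f \<in> {\<alpha>\<^sub>A, \<beta>\<^sub>A, \<psi>\<^sub>A, \<omega>\<^sub>A}" "a \<in> carrier A" for f a
    using assms(5) that unfolding bialgebra_endomorphism_def by blast
  have c: "\<alpha>\<^sub>A (\<beta>\<^sub>A a) = \<beta>\<^sub>A (\<alpha>\<^sub>A a)" "\<alpha>\<^sub>A (\<psi>\<^sub>A a) = \<psi>\<^sub>A (\<alpha>\<^sub>A a)" "\<alpha>\<^sub>A (\<omega>\<^sub>A a) = \<omega>\<^sub>A (\<alpha>\<^sub>A a)"
    "\<beta>\<^sub>A (\<psi>\<^sub>A a) = \<psi>\<^sub>A (\<beta>\<^sub>A a)" "\<beta>\<^sub>A (\<omega>\<^sub>A a) = \<omega>\<^sub>A (\<beta>\<^sub>A a)" "\<psi>\<^sub>A (\<omega>\<^sub>A a) = \<omega>\<^sub>A (\<psi>\<^sub>A a)"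
    if "a \<in> carrier A" for a
    using assms(6) that by blast+
  have cM: "\<alpha>\<^sub>M (\<beta>\<^sub>M m) = \<beta>\<^sub>M (\<alpha>\<^sub>M m)" "\<alpha>\<^sub>M (\<psi>\<^sub>M m) = \<psi>\<^sub>M (\<alpha>\<^sub>M m)" "\<alpha>\<^sub>M (\<omega>\<^sub>M m) = \<omega>\<^sub>M (\<alpha>\<^sub>M m)"
    "\<beta>\<^sub>M (\<psi>\<^sub>M m) = \<psi>\<^sub>M (\<beta>\<^sub>M m)" "\<beta>\<^sub>M (\<omega>\<^sub>M m) = \<omega>\<^sub>M (\<beta>\<^sub>M m)" "\<psi>\<^sub>M (\<omega>\<^sub>M m) = \<omega>\<^sub>M (\<psi>\<^sub>M m)"
    if "m \<in> carrier M" for m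
    using assms(8) that by blast+
  have acts: "\<alpha>\<^sub>M (lact a m) = lact (\<alpha>\<^sub>A a) (\<alpha>\<^sub>M m)" "\<beta>\<^sub>M (lact a m) = lact (\<beta>\<^sub>A a) (\<beta>\<^sub>M m)"
    "\<psi>\<^sub>M (lact a m) = lact (\<psi>\<^sub>A a) (\<psi>\<^sub>M m)" "\<omega>\<^sub>M (lact a m) = lact (\<omega>\<^sub>A a) (\<omega>\<^sub>M m)"
    "\<alpha>\<^sub>M (ract m a) = ract (\<alpha>\<^sub>M m) (\<alpha>\<^sub>A a)" "\<beta>\<^sub>M (ract m a) = ract (\<beta>\<^sub>M m) (\<beta>\<^sub>A a)"
    "\<psi>\<^sub>M (ract m a) = ract (\<psi>\<^sub>M m) (\<psi>\<^sub>A a)" "\<omega>\<^sub>M (ract m a) = ract (\<omega>\<^sub>M m) (\<omega>\<^sub>A a)"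
    if "a \<in> carrier A" "m \<in> carrier M" for a m
    using assms(9) that by simp_all
  have coacts:
    "tensor_map K A M \<alpha>\<^sub>A \<alpha>\<^sub>M (\<rho> m) = \<rho> (\<alpha>\<^sub>M m)" "tensor_map K A M \<beta>\<^sub>A \<beta>\<^sub>M (\<rho> m) = \<rho> (\<beta>\<^sub>M m)"
    "tensor_map K A M \<psi>\<^sub>A \<psi>\<^sub>M (\<rho> m) = \<rho> (\<psi>\<^sub>M m)" "tensor_map K A M \<omega>\<^sub>A \<omega>\<^sub>M (\<rho> m) = \<rho> (\<omega>\<^sub>M m)"
    "tensor_map K M A \<alpha>\<^sub>M \<alpha>\<^sub>A (\<phi> m) = \<phi> (\<alpha>\<^sub>M m)" "tensor_map K M A \<beta>\<^sub>M \<beta>\<^sub>A (\<phi> m) = \<phi> (\<beta>\<^sub>M m)"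
    "tensor_map K M A \<psi>\<^sub>M \<psi>\<^sub>A (\<phi> m) = \<phi> (\<psi>\<^sub>M m)" "tensor_map K M A \<omega>\<^sub>M \<omega>\<^sub>A (\<phi> m) = \<phi> (\<omega>\<^sub>M m)"
    if "m \<in> carrier M" for m
    using assms(9) that by simp_all
  have bialgebra: "infBH_bialgebra K lam A (\<lambda>a b. mult_A (\<alpha>\<^sub>A a) (\<beta>\<^sub>A b))
      (\<lambda>a. tensor_map K A A \<omega>\<^sub>A \<psi>\<^sub>A (\<Delta> a)) \<alpha>\<^sub>A \<beta>\<^sub>A \<psi>\<^sub>A \<omega>\<^sub>A"
    by (rule infBH_bialgebra_twist[OF assms(3,5,6)])
  have lact_assoc: "lact a (lact b m) = lact (mult_A a b) m"
    and ract_assoc: "ract m (mult_A a b) = ract (ract m a) b"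
    and lact_ract: "lact a (ract m b) = ract (lact a m) b"
    if "a \<in> carrier A" "b \<in> carrier A" "m \<in> carrier M" for a b m
    using H.lact_assoc H.ract_assoc H.lact_ract that by simp_all
  have bimodule: "bihom_bimodule K A (\<lambda>a b. mult_A (\<alpha>\<^sub>A a) (\<beta>\<^sub>A b)) \<alpha>\<^sub>A \<beta>\<^sub>A M
      (\<lambda>a m. lact (\<alpha>\<^sub>A a) (\<beta>\<^sub>M m)) (\<lambda>m a. ract (\<alpha>\<^sub>M m) (\<beta>\<^sub>A a)) \<alpha>\<^sub>M \<beta>\<^sub>M"
  proof (intro bihom_bimodule.intro bihom_bimodule_axioms.intro)
    show "(\<lambda>a m. lact (\<alpha>\<^sub>A a) (\<beta>\<^sub>M m)) \<in> bilinear_maps K A M M"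
      by (rule bilinear_maps_compose[OF lin(1) linM(2) H.lact_bilinear])
    show "(\<lambda>m a. ract (\<alpha>\<^sub>M m) (\<beta>\<^sub>A a)) \<in> bilinear_maps K M A M"
      by (rule bilinear_maps_compose[OF linM(1) lin(2) H.ract_bilinear])
  \<comment> \<open>In each of the three action laws the outer element of one bracketing receives
    \<alpha>\<alpha> or \<beta>\<beta> according to its side and the middle one \<alpha>\<beta>, so
    the laws reduce to the untwisted ones above.\<close>
  qed (use linM M infBH_bialgebra.axioms(1)[OF bialgebra] in
      \<open>simp_all add: acts mul c cM lact_assoc ract_assoc lact_ract\<close>)
  note twist_rho = tensor_map_commute[OF A M _ _ lin(4) linM(3)]
  note twist_phi = tensor_map_commute[OF M A _ _ linM(4) lin(3)]
  have bicomodule: "bihom_bicomodule K A (\<lambda>a. tensor_map K A A \<omega>\<^sub>A \<psi>\<^sub>A (\<Delta> a)) \<psi>\<^sub>A \<omega>\<^sub>A M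
      (\<lambda>m. tensor_map K A M \<omega>\<^sub>A \<psi>\<^sub>M (\<rho> m)) (\<lambda>m. tensor_map K M A \<omega>\<^sub>M \<psi>\<^sub>A (\<phi> m)) \<psi>\<^sub>M \<omega>\<^sub>M"
  proof (intro bihom_bicomodule.intro bihom_bicomodule_axioms.intro)
    show "(\<lambda>m. tensor_map K A M \<omega>\<^sub>A \<psi>\<^sub>M (\<rho> m)) \<in> linear_maps K M (tensor K A M)"
      by (rule linear_maps_compose[OF H.rho_linear tensor_map_linear[OF A M A M lin(4) linM(3)]])
    show "(\<lambda>m. tensor_map K M A \<omega>\<^sub>M \<psi>\<^sub>A (\<phi> m)) \<in> linear_maps K M (tensor K M A)"
      by (rule linear_maps_compose[OF H.phi_linear tensor_map_linear[OF M A M A linM(4) lin(3)]])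
    show "\<forall>m\<in>carrier M. tensor_map K A (tensor K A M) \<omega>\<^sub>A (\<lambda>m. tensor_map K A M \<omega>\<^sub>A \<psi>\<^sub>M (\<rho> m))
          (tensor_map K A M \<omega>\<^sub>A \<psi>\<^sub>M (\<rho> m)) =
        tensor_assoc K A A M (tensor_map K (tensor K A A) M (\<lambda>a. tensor_map K A A \<omega>\<^sub>A \<psi>\<^sub>A (\<Delta> a)) \<psi>\<^sub>M
          (tensor_map K A M \<omega>\<^sub>A \<psi>\<^sub>M (\<rho> m)))"
      \<comment> \<open>\<open>P\<close> is \<open>A\<close> with coproduct \<open>\<Delta>\<close>,
        \<open>Q\<close> is \<open>M\<close> with coaction \<open>\<rho>\<close>; \<open>L\<close>
        and \<open>R\<close> are both \<open>\<rho> m\<close>.\<close>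
      using H.rho_coassoc
      by (intro ballI coassociativity_twist[OF A A M A M H.Delta_linear H.rho_linear _ _ _
            lin(4,4,3) linM(3) lin(4) linM(3), symmetric])
        (simp_all add: Delta c coacts)
    show "\<forall>m\<in>carrier M. tensor_map K M (tensor K A A) \<omega>\<^sub>M (\<lambda>a. tensor_map K A A \<omega>\<^sub>A \<psi>\<^sub>A (\<Delta> a))
          (tensor_map K M A \<omega>\<^sub>M \<psi>\<^sub>A (\<phi> m)) =
        tensor_assoc K M A A (tensor_map K (tensor K M A) A (\<lambda>m. tensor_map K M A \<omega>\<^sub>M \<psi>\<^sub>A (\<phi> m)) \<psi>\<^sub>A
          (tensor_map K M A \<omega>\<^sub>M \<psi>\<^sub>A (\<phi> m)))"
      \<comment> \<open>\<open>P\<close> is \<open>M\<close> with coaction \<open>\<phi>\<close>,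
        \<open>Q\<close> is \<open>A\<close> with coproduct \<open>\<Delta>\<close>;
        \<open>L\<close> and \<open>R\<close> are both \<open>\<phi> m\<close>.\<close>
      using H.phi_coassoc
      by (intro ballI coassociativity_twist[OF M A A M A H.phi_linear H.Delta_linear _ _ _
            linM(4) lin(4,3,3) linM(4) lin(3), symmetric])
        (simp_all add: Delta c coacts)
    show "\<forall>m\<in>carrier M. tensor_map K A (tensor K M A) \<omega>\<^sub>A (\<lambda>m. tensor_map K M A \<omega>\<^sub>M \<psi>\<^sub>A (\<phi> m))
          (tensor_map K A M \<omega>\<^sub>A \<psi>\<^sub>M (\<rho> m)) =
        tensor_assoc K A M A (tensor_map K (tensor K A M) A (\<lambda>m. tensor_map K A M \<omega>\<^sub>A \<psi>\<^sub>M (\<rho> m)) \<psi>\<^sub>A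
          (tensor_map K M A \<omega>\<^sub>M \<psi>\<^sub>A (\<phi> m)))"
      \<comment> \<open>In this case \<open>L\<close> is \<open>\<phi> m\<close> and
        \<open>R\<close> is \<open>\<rho> m\<close>, the reason for keeping them apart in
        \<open>coassociativity_twist\<close>. The middle slot is \<open>M\<close>, so commutation of
        the maps on \<open>M\<close> is used.\<close>
      using H.rho_phi
      by (intro ballI coassociativity_twist[OF A M A M M H.rho_linear H.phi_linear _ _ _
            lin(4) linM(4,3) lin(3) linM(4,3), symmetric])
        (simp_all add: cM coacts)
  qed (use linM M infBH_bialgebra.axioms(2)[OF bialgebra] lin in
      \<open>simp_all add: c cM twist_rho twist_phi coacts\<close>)
  show ?thesis
  proof (intro infBH_Hopf_bimodule.intro infBH_Hopf_bimodule_axioms.intro bialgebra bimodule bicomodule ballI)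
    fix a m assume a: "a \<in> carrier A" and m: "m \<in> carrier M"
    show "tensor_map K A M \<omega>\<^sub>A \<psi>\<^sub>M (\<rho> (lact (\<alpha>\<^sub>A a) (\<beta>\<^sub>M m))) =
        tensor_map K A M (\<lambda>x. mult_A (\<alpha>\<^sub>A (\<omega>\<^sub>A a)) (\<beta>\<^sub>A x)) \<beta>\<^sub>M (tensor_map K A M \<omega>\<^sub>A \<psi>\<^sub>M (\<rho> m))
        \<oplus>\<^bsub>tensor K A M\<^esub> tensor_map K A M \<alpha>\<^sub>A (\<lambda>x. lact (\<alpha>\<^sub>A x) (\<beta>\<^sub>M (\<psi>\<^sub>M m))) (tensor_map K A A \<omega>\<^sub>A \<psi>\<^sub>A (\<Delta> a))
        \<oplus>\<^bsub>tensor K A M\<^esub> lam \<odot>\<^bsub>tensor K A M\<^esub> pure_tensor K A M (\<alpha>\<^sub>A (\<omega>\<^sub>A a)) (\<beta>\<^sub>M (\<psi>\<^sub>M m))"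
      \<comment> \<open>\<open>X\<close> is \<open>A\<close> and \<open>Y\<close> is
        \<open>M\<close>: \<open>lmul\<close> is the product of \<open>A\<close>,
        \<open>rmul\<close> the left action, \<open>dX\<close> is \<open>\<Delta>\<close> and
        \<open>dY\<close> is \<open>\<rho>\<close>.\<close>
      using H.rho_lact a m
      by (intro derivation_twist[OF A A M H.lam_closed H.mult_bilinear H.lact_bilinear H.Delta_linear
            H.rho_linear _ lin lin(1,4) linM(2,3)])
        (simp_all add: mul acts c cM Delta coacts)
    show "tensor_map K M A \<omega>\<^sub>M \<psi>\<^sub>A (\<phi> (ract (\<alpha>\<^sub>M m) (\<beta>\<^sub>A a))) =
        tensor_map K M A (\<lambda>x. ract (\<alpha>\<^sub>M (\<omega>\<^sub>M m)) (\<beta>\<^sub>A x)) \<beta>\<^sub>A (tensor_map K A A \<omega>\<^sub>A \<psi>\<^sub>A (\<Delta> a))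
        \<oplus>\<^bsub>tensor K M A\<^esub> tensor_map K M A \<alpha>\<^sub>M (\<lambda>x. mult_A (\<alpha>\<^sub>A x) (\<beta>\<^sub>A (\<psi>\<^sub>A a))) (tensor_map K M A \<omega>\<^sub>M \<psi>\<^sub>A (\<phi> m))
        \<oplus>\<^bsub>tensor K M A\<^esub> lam \<odot>\<^bsub>tensor K M A\<^esub> pure_tensor K M A (\<alpha>\<^sub>M (\<omega>\<^sub>M m)) (\<beta>\<^sub>A (\<psi>\<^sub>A a))"
      \<comment> \<open>\<open>X\<close> is \<open>M\<close> and \<open>Y\<close> is
        \<open>A\<close>: \<open>lmul\<close> is the right action, \<open>rmul\<close> the product
        of \<open>A\<close>, \<open>dX\<close> is \<open>\<phi>\<close> and \<open>dY\<close> is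
        \<open>\<Delta>\<close>.\<close>
      using H.phi_ract a m
      by (intro derivation_twist[OF A M A H.lam_closed H.ract_bilinear H.mult_bilinear H.phi_linear
            H.Delta_linear _ lin linM(1,4) lin(2,3)])
        (simp_all add: mul acts c cM Delta coacts)
    \<comment> \<open>The two mixed compatibilities have a single term, so
      \<open>derivation_twist\<close> does not apply. The inner \<beta> (respectively \<alpha>) is
      brought outside the coaction, and commuting squares in the two tensor factors finish the
      argument.\<close>
    have phi_lact: "\<phi> (lact (\<alpha>\<^sub>A a) (\<beta>\<^sub>M m)) = tensor_map K M A (\<lambda>x. lact (\<alpha>\<^sub>A a) x) id (tensor_map K M A \<beta>\<^sub>M \<beta>\<^sub>A (\<phi> m))"
      using H.phi_lact a m by (simp add: coacts)
    have rho_ract: "\<rho> (ract (\<alpha>\<^sub>M m) (\<beta>\<^sub>A a)) = tensor_map K A M id (\<lambda>x. ract x (\<beta>\<^sub>A a)) (tensor_map K A M \<alpha>\<^sub>A \<alpha>\<^sub>M (\<rho> m))"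
      using H.rho_ract a m by (simp add: coacts)
    have a': "\<alpha>\<^sub>A a \<in> carrier A" "\<beta>\<^sub>A a \<in> carrier A" "\<alpha>\<^sub>A (\<omega>\<^sub>A a) \<in> carrier A" "\<beta>\<^sub>A (\<psi>\<^sub>A a) \<in> carrier A"
      and m': "\<phi> m \<in> carrier (tensor K M A)" "\<rho> m \<in> carrier (tensor K A M)"
      using a m by simp_all
    note l = bilinear_maps_left[OF H.lact_bilinear a'(1)]
      and l' = linear_maps_compose[OF linM(2) bilinear_maps_left[OF H.lact_bilinear a'(3)]]
      and r = bilinear_maps_right[OF H.ract_bilinear a'(2)]
      and r' = linear_maps_compose[OF linM(1) bilinear_maps_right[OF H.ract_bilinear a'(4)]]
    show "tensor_map K M A \<omega>\<^sub>M \<psi>\<^sub>A (\<phi> (lact (\<alpha>\<^sub>A a) (\<beta>\<^sub>M m))) =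
        tensor_map K M A (\<lambda>x. lact (\<alpha>\<^sub>A (\<omega>\<^sub>A a)) (\<beta>\<^sub>M x)) \<beta>\<^sub>A (tensor_map K M A \<omega>\<^sub>M \<psi>\<^sub>A (\<phi> m))"
      unfolding phi_lact tensor_map_compose[OF M A M A M A linM(2) lin(2) l linear_maps_id m'(1)]
      by (rule tensor_map_compose_eq[OF M A M A M A M A linear_maps_compose[OF linM(2) l]
            linear_maps_compose[OF lin(2) linear_maps_id] linM(4) lin(3) linM(4) lin(3) l' lin(2) _ _ m'(1)])
        (simp_all add: a acts c cM)
    show "tensor_map K A M \<omega>\<^sub>A \<psi>\<^sub>M (\<rho> (ract (\<alpha>\<^sub>M m) (\<beta>\<^sub>A a))) =
        tensor_map K A M \<alpha>\<^sub>A (\<lambda>x. ract (\<alpha>\<^sub>M x) (\<beta>\<^sub>A (\<psi>\<^sub>A a))) (tensor_map K A M \<omega>\<^sub>A \<psi>\<^sub>M (\<rho> m))"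
      unfolding rho_ract tensor_map_compose[OF A M A M A M lin(1) linM(1) linear_maps_id r m'(2)]
      by (rule tensor_map_compose_eq[OF A M A M A M A M linear_maps_compose[OF lin(1) linear_maps_id]
            linear_maps_compose[OF linM(1) r] lin(4) linM(3) lin(4) linM(3) lin(1) r' _ _ m'(2)])
        (simp_all add: a acts c cM)
  qed (simp_all add: cM)
qed

end
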